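(* Let $P$ be a polynomial of degree $\lambda\ge 1$ with $\mathrm{Re}\,P(ix)=0$ for all $x\in\mathbb{R}$, let $T>0$, and fix $0\le\sigma\le 1$ and $r\ge 0$ such that $r+1-2\sigma+\lambda>1/2$. Then there is a function $K:[0,\infty)\to(0,\infty)$ (depending only on $r,\sigma,P,T$, and in particular not on $\varepsilon$, $\tau$, $n$) such that the following holds. Let $0<\varepsilon\le 1$ and assume that the exact solution $u$ of the equation $$\partial_t u+\mathcal{L}_{\varepsilon,\lambda}u+\varepsilon\mathcal{L}_\varepsilon(u^2)=0\quad\text{on }\mathbb{T}$$ satisfies $u\in\mathcal{C}([0,T],H^{r+1-2\sigma+\lambda}(\mathbb{T}))$. Then there exists $\tau_0>0$ such that for all $0<\tau\le\tau_0$ and all $n$ with $t_n=n\tau\le T$, the Lie splitting approximation defined by $$u^{n+1}=e^{-\tau\mathcal{L}_{\varepsilon,\lambda}}\big(u^n-\tau\varepsilon\mathcal{L}_\varepsilon (u^n)^2\big),\qquad u^0=u(0),$$ satisfies $$\|u(t_n)-u^n\|_r\le \tau\,\varepsilon^{1-\sigma}K\Big(\sup_{t\in[0,T]}\|u(t)\|_{r+1-2\sigma+\lambda}\Big).$$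
   Context: $\mathbb{T}=[-\pi,\pi]$ with periodic boundary conditions. For $s\in\mathbb{R}$, $\|\cdot\|_s$ is the standard $H^s(\mathbb{T})$ norm, defined through Fourier coefficients. The operators are the Fourier multipliers $\mathcal{L}_\varepsilon=\frac{\partial_x}{1-\varepsilon\partial_x^2}$ with symbol $\frac{ik}{1+\varepsilon k^2}$, $\mathcal{L}_{\varepsilon,\lambda}=\frac{P(\partial_x)}{1-\varepsilon\partial_x^2}$ with symbol $\frac{P(ik)}{1+\varepsilon k^2}$, and $e^{t\mathcal{L}_{\varepsilon,\lambda}}$ with symbol $e^{tP(ik)/(1+\varepsilon k^2)}$, $k\in\mathbb{Z}$. Solutions of the (Benjamin--Bona--Mahony) equation are understood in the mild sense: $u(t)=e^{-t\mathcal{L}_{\varepsilon,\lambda}}u(0)-\varepsilon\mathcal{L}_\varepsilon\int_0^t e^{-(t-s)\mathcal{L}_{\varepsilon,\lambda}}u^2(s)\,ds$. *)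

theory Defs
  imports "HOL-Analysis.Analysis" "HOL-Computational_Algebra.Polynomial"
begin

text \<open>
  Elements of \<open>H\<^sup>s\<close> of the torus (for \<open>s \<ge> 0\<close>, the only case used) are represented by functions
  \<open>real \<Rightarrow> complex\<close> of which only the restriction to \<open>[-\<pi>, \<pi>]\<close>, up to null sets, is relevant.
  The end points are a null set, so no periodicity needs to be imposed.
\<close>

abbreviation torus :: "real measure" where
  "torus \<equiv> lebesgue_on {-pi..pi}"

definition fourier_coeff :: "(real \<Rightarrow> complex) \<Rightarrow> int \<Rightarrow> complex" where
  "fourier_coeff f k = (LINT x|torus. f x * exp (- (\<i> * of_int k * of_real x))) / (2 * of_real pi)"

definition sobolev :: "real \<Rightarrow> (real \<Rightarrow> complex) set" where
  "sobolev s = {f. f \<in> borel_measurable torus \<and> integrable torus (\<lambda>x. (cmod (f x))\<^sup>2) \<and>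
     (\<lambda>k. (1 + (of_int k)\<^sup>2) powr s * (cmod (fourier_coeff f k))\<^sup>2) summable_on (UNIV :: int set)}"

text \<open>
  Meaningful on \<open>sobolev s\<close> only: a divergent sum would get the value \<open>0\<close>.
\<close>
definition sobolev_norm :: "real \<Rightarrow> (real \<Rightarrow> complex) \<Rightarrow> real" where
  "sobolev_norm s f =
     sqrt (\<Sum>\<^sub>\<infinity>k::int. (1 + (of_int k)\<^sup>2) powr s * (cmod (fourier_coeff f k))\<^sup>2)"

text \<open>
  The space \<open>C([0,T], H\<^sup>s)\<close>.
\<close>
definition cont_sobolev :: "real \<Rightarrow> real \<Rightarrow> (real \<Rightarrow> real \<Rightarrow> complex) set" where
  "cont_sobolev T s = {u. (\<forall>t\<in>{0..T}. u t \<in> sobolev s) \<and>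
     (\<forall>t\<in>{0..T}. ((\<lambda>t'. sobolev_norm s (\<lambda>x. u t' x - u t x)) \<longlongrightarrow> 0) (at t within {0..T}))}"

text \<open>
  The Fourier multiplier with symbol \<open>m\<close>, as the sum of its Fourier series. Below, \<open>m\<close> is bounded
  and is applied to elements of \<open>H\<^sup>s\<close> with \<open>s > 1/2\<close> (an algebra, so this covers squares), for
  which the series converges absolutely.
\<close>
definition fourier_multiplier ::
    "(int \<Rightarrow> complex) \<Rightarrow> (real \<Rightarrow> complex) \<Rightarrow> real \<Rightarrow> complex" where
  "fourier_multiplier m f x =
     (\<Sum>\<^sub>\<infinity>k::int. m k * fourier_coeff f k * exp (\<i> * of_int k * of_real x))"

definition symbol_L :: "real \<Rightarrow> int \<Rightarrow> complex" where
  "symbol_L \<epsilon> k = \<i> * of_int k / (1 + of_real \<epsilon> * (of_int k)\<^sup>2)"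

definition symbol_LP :: "complex poly \<Rightarrow> real \<Rightarrow> int \<Rightarrow> complex" where
  "symbol_LP P \<epsilon> k = poly P (\<i> * of_int k) / (1 + of_real \<epsilon> * (of_int k)\<^sup>2)"

definition op_L :: "real \<Rightarrow> (real \<Rightarrow> complex) \<Rightarrow> real \<Rightarrow> complex" where
  "op_L \<epsilon> = fourier_multiplier (symbol_L \<epsilon>)"

definition exp_LP ::
    "complex poly \<Rightarrow> real \<Rightarrow> real \<Rightarrow> (real \<Rightarrow> complex) \<Rightarrow> real \<Rightarrow> complex" where
  "exp_LP P \<epsilon> t = fourier_multiplier (\<lambda>k. exp (of_real t * symbol_LP P \<epsilon> k))"

text \<open>
  Mild solutions on \<open>[0,T]\<close>. For \<open>u\<close> in \<open>C([0,T], H\<^sup>s)\<close>, \<open>s > 1/2\<close>, the integrand is continuous in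
  \<open>(s, x)\<close>, so the vector-valued integral can be taken pointwise in \<open>x\<close>.
\<close>
definition mild_solution ::
    "complex poly \<Rightarrow> real \<Rightarrow> real \<Rightarrow> (real \<Rightarrow> real \<Rightarrow> complex) \<Rightarrow> bool" where
  "mild_solution P \<epsilon> T u \<longleftrightarrow> (\<forall>t\<in>{0..T}. AE x in torus.
     u t x = exp_LP P \<epsilon> (- t) (u 0) x
       - of_real \<epsilon> * op_L \<epsilon>
           (\<lambda>y. integral {0..t} (\<lambda>s. exp_LP P \<epsilon> (- (t - s)) (\<lambda>z. (u s z)\<^sup>2) y)) x)"

primrec lie_splitting ::
    "complex poly \<Rightarrow> real \<Rightarrow> real \<Rightarrow> (real \<Rightarrow> complex) \<Rightarrow> nat \<Rightarrow> real \<Rightarrow> complex" where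
  "lie_splitting P \<epsilon> \<tau> u0 0 = u0"
| "lie_splitting P \<epsilon> \<tau> u0 (Suc n) =
     exp_LP P \<epsilon> (- \<tau>) (\<lambda>x. lie_splitting P \<epsilon> \<tau> u0 n x
       - of_real \<tau> * of_real \<epsilon> * op_L \<epsilon> (\<lambda>y. (lie_splitting P \<epsilon> \<tau> u0 n y)\<^sup>2) x)"

end

theory Submission imports Defs begin

text \<open>
  On Fourier coefficients the problem becomes one for sequences in weighted \<open>\<ell>\<^sup>2\<close> spaces; the mild
  equation itself shows that \<open>u t\<close> agrees almost everywhere with an absolutely convergent
  Fourier series, so its square has the convolution square as coefficients. Put
  \<open>s = r + 1 - 2\<sigma> + \<lambda>\<close> and \<open>p = max (s - \<lambda>) 0\<close>. With \<open>w k = 1 + k\<^sup>2\<close> the multiplier \<open>\<epsilon>L\<^sub>\<epsilon>\<close> is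
  bounded by \<open>2 \<epsilon>\<^sup>\<theta> w\<^bsup>\<theta> - 1/2\<^esup>\<close> and the linear generator by \<open>C \<epsilon>\<^bsup>-\<mu>\<^esup> w\<^bsup>\<lambda>/2 - \<mu>\<^esup>\<close>, for all
  \<open>\<theta>, \<mu> \<in> [0,1]\<close>. Choosing \<open>\<mu> = (p - (s - \<lambda>)) / 2\<close> and \<open>\<theta> = 1 - \<sigma> + \<mu>\<close>, the generator maps
  \<open>H\<^sup>s\<close> to \<open>H\<^sup>p\<close>, \<open>\<epsilon>L\<^sub>\<epsilon>\<close> maps \<open>H\<^sup>p\<close> to \<open>H\<^sup>r\<close>, and the powers of \<open>\<epsilon>\<close> multiply to \<open>\<epsilon>\<^bsup>1 - \<sigma>\<^esup>\<close>. Since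
  \<open>p \<ge> 0\<close>, products are only estimated in spaces of nonnegative order, and the local error is
  \<open>O(\<tau>\<^sup>2 \<epsilon>\<^bsup>1 - \<sigma>\<^esup>)\<close> in \<open>H\<^sup>r\<close>. For stability, the difference of two squares is \<open>2 u e - e\<^sup>2\<close>; the
  first term is estimated by \<open>H\<^sup>s \<cdot> H\<^sup>r \<subseteq> H\<^sup>r\<close>, the second by \<open>H\<^sup>r \<cdot> H\<^sup>r \<subseteq> H\<^bsup>r - 1\<^esup>\<close> and the gain of
  one derivative in \<open>\<epsilon>L\<^sub>\<epsilon>\<close>, and a bootstrap keeps the error below \<open>1\<close>.
\<close>

section \<open>Weighted sequence spaces\<close>

definition wt :: "int \<Rightarrow> real" where
  "wt k = 1 + (of_int k)\<^sup>2"

definition in_h :: "real \<Rightarrow> (int \<Rightarrow> complex) \<Rightarrow> bool" where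
  "in_h s a \<longleftrightarrow> (\<lambda>k. wt k powr s * (cmod (a k))\<^sup>2) summable_on UNIV"

definition h_norm :: "real \<Rightarrow> (int \<Rightarrow> complex) \<Rightarrow> real" where
  "h_norm s a = sqrt (\<Sum>\<^sub>\<infinity>k. wt k powr s * (cmod (a k))\<^sup>2)"

text \<open>Finite sections of the norm. Estimates are proved on them with the inequalities for
  \<open>L2_set\<close> and reach the full norm by uniformity in \<open>F\<close>; the exponent is
  halved because \<open>L2_set\<close> squares.\<close>

abbreviation h_part :: "real \<Rightarrow> (int \<Rightarrow> complex) \<Rightarrow> int set \<Rightarrow> real" where
  "h_part s a F \<equiv> L2_set (\<lambda>k. wt k powr (s / 2) * cmod (a k)) F"

abbreviation ell1 :: "(int \<Rightarrow> complex) \<Rightarrow> bool" where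
  "ell1 a \<equiv> (\<lambda>k. cmod (a k)) summable_on UNIV"

lemma wt_ge_1: "1 \<le> wt k"
  by (simp add: wt_def)

lemma wt_pos [simp]: "0 < wt k" and wt_nonneg [simp]: "0 \<le> wt k" and wt_nz [simp]: "wt k \<noteq> 0"
  using wt_ge_1[of k] by linarith+

lemma abs_le_sqrt_wt: "\<bar>of_int k\<bar> \<le> wt k powr (1 / 2)"
  by (simp add: powr_half_sqrt wt_def real_le_rsqrt)

lemma wt_le_sum: "wt k \<le> 2 * (wt (k - j) + wt j)"
proof -
  have "0 \<le> (real_of_int (k - j) - real_of_int j)\<^sup>2"
    by simp
  then show ?thesis
    by (simp add: wt_def power2_eq_square algebra_simps)
qed

text \<open>Peetre's inequality in product form: with x = k - j and y = j, the right side exceeds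
  the left by 1 + (x - y)^2 + 2 (x y)^2. It distributes a weight over both factors of a
  product.\<close>

lemma wt_le_prod: "wt k \<le> 2 * (wt (k - j) * wt j)"
proof -
  have "0 \<le> (real_of_int (k - j) - real_of_int j)\<^sup>2 + 2 * (real_of_int (k - j) * real_of_int j)\<^sup>2"
    by simp
  then show ?thesis
    by (simp add: wt_def power2_eq_square algebra_simps)
qed

lemma weighted_square: "(wt k powr (s / 2) * c)\<^sup>2 = wt k powr s * c\<^sup>2"
  by (simp add: power_mult_distrib powr_power)

lemma h_part_square: "(h_part s a F)\<^sup>2 = (\<Sum>k\<in>F. wt k powr s * (cmod (a k))\<^sup>2)"
  unfolding L2_set_def by (simp add: weighted_square sum_nonneg)

text \<open>Monotone convergence: one bound uniform over finite index sets yields summability and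
  the norm bound together.\<close>

lemma in_hI:
  assumes "\<And>F. finite F \<Longrightarrow> h_part s a F \<le> B"
  shows "in_h s a" and "h_norm s a \<le> B"
proof -
  have B: "0 \<le> B"
    using assms[of "{}"] by simp
  have le: "(\<Sum>k\<in>F. wt k powr s * (cmod (a k))\<^sup>2) \<le> B\<^sup>2" if "finite F" for F
    using power_mono[OF assms[OF that] L2_set_nonneg, of 2] by (simp add: h_part_square)
  have sm: "(\<lambda>k. wt k powr s * (cmod (a k))\<^sup>2) summable_on UNIV"
    by (rule nonneg_bdd_above_summable_on) (auto intro!: bdd_aboveI2 le)
  then show "in_h s a"
    by (simp add: in_h_def)
  have "(\<Sum>\<^sub>\<infinity>k. wt k powr s * (cmod (a k))\<^sup>2) \<le> B\<^sup>2"
    by (intro infsum_le_finite_sums sm le)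
  then show "h_norm s a \<le> B"
    unfolding h_norm_def using B by (simp add: real_le_lsqrt)
qed

lemma h_norm_nonneg [simp]: "0 \<le> h_norm s a"
  unfolding h_norm_def by (intro real_sqrt_ge_zero infsum_nonneg) simp

lemma h_norm_square: "(h_norm s a)\<^sup>2 = (\<Sum>\<^sub>\<infinity>k. wt k powr s * (cmod (a k))\<^sup>2)"
  unfolding h_norm_def by (intro real_sqrt_pow2 infsum_nonneg) simp

lemma h_part_le:
  assumes "in_h s a" "finite F"
  shows "h_part s a F \<le> h_norm s a"
proof (rule power2_le_imp_le)
  show "(h_part s a F)\<^sup>2 \<le> (h_norm s a)\<^sup>2"
    unfolding h_part_square h_norm_square
    using assms by (intro finite_sum_le_infsum) (auto simp: in_h_def)
qed simp

lemma h_point_le: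
  assumes "in_h s a"
  shows "wt k powr (s / 2) * cmod (a k) \<le> h_norm s a"
  using h_part_le[OF assms, of "{k}"] by (simp add: abs_mult)

lemma h_dominated:
  assumes "in_h s a" and "0 \<le> c"
    and "\<And>k. wt k powr (p / 2) * cmod (b k) \<le> c * (wt k powr (s / 2) * cmod (a k))"
  shows "in_h p b" and "h_norm p b \<le> c * h_norm s a"
proof -
  have *: "h_part p b F \<le> c * h_norm s a" if "finite F" for F
  proof -
    have "h_part p b F \<le> L2_set (\<lambda>k. c * (wt k powr (s / 2) * cmod (a k))) F"
      by (intro L2_set_mono assms) simp
    also have "\<dots> = c * h_part s a F"
      by (simp add: L2_set_right_distrib assms)
    also have "\<dots> \<le> c * h_norm s a"
      by (intro mult_left_mono h_part_le assms that)
    finally show ?thesis .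
  qed
  show "in_h p b" "h_norm p b \<le> c * h_norm s a"
    using in_hI[OF *] by auto
qed

text \<open>The form suited to Fourier multipliers: growth of order \<open>(s - p) / 2\<close> in
  \<open>wt\<close> is exactly what the passage from H^s to H^p allows.\<close>

lemma h_dominated':
  assumes "in_h s a" and "0 \<le> c"
    and "\<And>k. cmod (b k) \<le> c * wt k powr ((s - p) / 2) * cmod (a k)"
  shows "in_h p b" and "h_norm p b \<le> c * h_norm s a"
proof -
  have *: "wt k powr (p / 2) * cmod (b k) \<le> c * (wt k powr (s / 2) * cmod (a k))" for k
  proof -
    have "wt k powr (p / 2) * cmod (b k)
        \<le> wt k powr (p / 2) * (c * wt k powr ((s - p) / 2) * cmod (a k))"
      by (intro mult_left_mono assms) simp
    also have "\<dots> = c * (wt k powr (p / 2 + (s - p) / 2) * cmod (a k))"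
      by (simp add: powr_add)
    also have "p / 2 + (s - p) / 2 = s / 2"
      by (simp add: field_simps)
    finally show ?thesis .
  qed
  show "in_h p b" "h_norm p b \<le> c * h_norm s a"
    using h_dominated[OF assms(1,2) *] by auto
qed

lemma h_embed:
  assumes "in_h s a" "p \<le> s"
  shows "in_h p a" and "h_norm p a \<le> h_norm s a"
proof -
  have "wt k powr (p / 2) * cmod (a k) \<le> 1 * (wt k powr (s / 2) * cmod (a k))" for k
    using assms(2) wt_ge_1[of k] by (auto intro!: mult_right_mono powr_mono)
  from h_dominated[OF assms(1) _ this] show "in_h p a" "h_norm p a \<le> h_norm s a"
    by auto
qed

lemma h_add:
  assumes "in_h s a" "in_h s b"
  shows "in_h s (\<lambda>k. a k + b k)" and "h_norm s (\<lambda>k. a k + b k) \<le> h_norm s a + h_norm s b"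
proof -
  have *: "h_part s (\<lambda>k. a k + b k) F \<le> h_norm s a + h_norm s b" if "finite F" for F
  proof -
    have "h_part s (\<lambda>k. a k + b k) F
        \<le> L2_set (\<lambda>k. wt k powr (s / 2) * cmod (a k) + wt k powr (s / 2) * cmod (b k)) F"
      by (intro L2_set_mono) (auto simp: norm_triangle_ineq simp flip: distrib_left)
    also have "\<dots> \<le> h_part s a F + h_part s b F"
      by (rule L2_set_triangle_ineq)
    also have "\<dots> \<le> h_norm s a + h_norm s b"
      by (intro add_mono h_part_le assms that)
    finally show ?thesis .
  qed
  show "in_h s (\<lambda>k. a k + b k)" "h_norm s (\<lambda>k. a k + b k) \<le> h_norm s a + h_norm s b"
    using in_hI[OF *] by auto
qed

lemma h_cmult:
  assumes "in_h s a"
  shows "in_h s (\<lambda>k. c * a k)" and "h_norm s (\<lambda>k. c * a k) \<le> cmod c * h_norm s a"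
  using h_dominated[OF assms, of "cmod c" s "\<lambda>k. c * a k"] by (auto simp: norm_mult)

lemma h_uminus:
  shows "in_h s (\<lambda>k. - a k) \<longleftrightarrow> in_h s a" and "h_norm s (\<lambda>k. - a k) = h_norm s a"
  by (simp_all add: in_h_def h_norm_def)

lemma h_diff:
  assumes "in_h s a" "in_h s b"
  shows "in_h s (\<lambda>k. a k - b k)" and "h_norm s (\<lambda>k. a k - b k) \<le> h_norm s a + h_norm s b"
  using h_add[OF assms(1), of "\<lambda>k. - b k"] assms(2) by (simp_all add: h_uminus)

text \<open>Minkowski's integral inequality by duality: the section of the integral is paired with
  itself, the pairing is moved under the integral and estimated there by Cauchy--Schwarz.\<close>

lemma h_integral:
  assumes "0 \<le> t" and cont: "\<And>k. continuous_on {0..t} (\<lambda>x. f x k)"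
    and f: "\<And>x. x \<in> {0..t} \<Longrightarrow> in_h s (f x)" "\<And>x. x \<in> {0..t} \<Longrightarrow> h_norm s (f x) \<le> B"
  shows "in_h s (\<lambda>k. integral {0..t} (\<lambda>x. f x k))"
    and "h_norm s (\<lambda>k. integral {0..t} (\<lambda>x. f x k)) \<le> t * B"
proof -
  define g where "g k = integral {0..t} (\<lambda>x. f x k)" for k
  have B: "0 \<le> B"
    using order_trans[OF h_norm_nonneg f(2)[of 0]] assms(1) by simp
  have *: "h_part s g F \<le> t * B" if F: "finite F" for F
  proof -
    define v where "v k = wt k powr (s / 2) * cmod (g k)" for k
    have v0: "0 \<le> v k" for k
      by (simp add: v_def)
    have ni: "(\<lambda>x. cmod (f x k)) integrable_on {0..t}" for k
      by (intro integrable_continuous_interval continuous_on_norm cont)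
    \<comment> \<open>One factor of the square is kept as the dual vector \<open>v\<close>; only the
      other is replaced by the integral of the moduli.\<close>
    have "(h_part s g F)\<^sup>2 = (\<Sum>k\<in>F. v k * (wt k powr (s / 2) * cmod (g k)))"
      unfolding h_part_square v_def
      by (intro sum.cong refl) (metis weighted_square power2_eq_square)
    also have "\<dots> \<le> (\<Sum>k\<in>F. v k * (wt k powr (s / 2) * integral {0..t} (\<lambda>x. cmod (f x k))))"
      unfolding g_def
      by (intro sum_mono mult_left_mono integral_norm_bound_integral ni v0
          integrable_continuous_interval cont) auto
    also have "\<dots> = integral {0..t} (\<lambda>x. \<Sum>k\<in>F. v k * (wt k powr (s / 2) * cmod (f x k)))"
      by (subst integral_sum) (auto intro!: F integrable_on_mult_right ni simp: mult.assoc[symmetric])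
    also have "\<dots> \<le> integral {0..t} (\<lambda>x. h_part s g F * B)"
    proof (rule integral_le)
      show "(\<lambda>x. \<Sum>k\<in>F. v k * (wt k powr (s / 2) * cmod (f x k))) integrable_on {0..t}"
        by (auto intro!: integrable_sum F integrable_on_mult_right ni simp: mult.assoc[symmetric])
      fix x assume x: "x \<in> {0..t}"
      have "(\<Sum>k\<in>F. v k * (wt k powr (s / 2) * cmod (f x k)))
          = (\<Sum>k\<in>F. \<bar>v k\<bar> * \<bar>wt k powr (s / 2) * cmod (f x k)\<bar>)"
        using v0 by simp
      also have "\<dots> \<le> L2_set v F * h_part s (f x) F"
        by (rule L2_set_mult_ineq)
      also have "\<dots> \<le> h_part s g F * B"
        unfolding v_def using h_part_le[OF f(1)[OF x] F] f(2)[OF x]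
        by (intro mult_left_mono) auto
      finally show "(\<Sum>k\<in>F. v k * (wt k powr (s / 2) * cmod (f x k))) \<le> h_part s g F * B" .
    qed (intro integrable_continuous_interval continuous_on_const)
    also have "\<dots> = h_part s g F * (t * B)"
      using assms(1) by simp
    finally have "h_part s g F * h_part s g F \<le> h_part s g F * (t * B)"
      by (simp add: power2_eq_square)
    then show ?thesis
      using B assms(1) L2_set_nonneg[of "\<lambda>k. wt k powr (s / 2) * cmod (g k)" F]
      by (cases "h_part s g F = 0") (auto simp: mult_le_cancel_left)
  qed
  show "in_h s (\<lambda>k. integral {0..t} (\<lambda>x. f x k))"
    and "h_norm s (\<lambda>k. integral {0..t} (\<lambda>x. f x k)) \<le> t * B"
    using in_hI[OF *] by (auto simp: g_def)
qed

section \<open>Summability of powers of the weight, and Cauchy--Schwarz\<close>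

lemma summable_wt_powr:
  assumes "1 / 2 < s"
  shows "(\<lambda>k. wt k powr - s) summable_on UNIV"
proof -
  have sm: "(\<lambda>n::nat. (real n) powr (- (2 * s))) summable_on UNIV"
    using assms by (intro summable_nonneg_imp_summable_on) (auto simp: summable_real_powr_iff)
  have le: "wt k powr - s \<le> \<bar>of_int k\<bar> powr - (2 * s)" if "k \<noteq> 0" for k
  proof -
    have "wt k powr - s \<le> ((of_int k)\<^sup>2) powr - s"
      using assms that by (intro powr_mono2') (auto simp: wt_def)
    also have "((of_int k)\<^sup>2 :: real) = \<bar>of_int k\<bar> powr 2"
      using that by simp
    finally show ?thesis
      by (simp only: powr_powr mult_minus_right)
  qed
  have pos: "(\<lambda>n::nat. wt (int n) powr - s) summable_on UNIV"
  proof -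
    \<comment> \<open>Index 0 is split off because \<open>0 powr _\<close> is 0, so the comparison
      with the p-series fails there.\<close>
    have "(\<lambda>n::nat. wt (int n) powr - s) summable_on (UNIV - {0})"
    proof (rule summable_on_comparison_test)
      show "(\<lambda>n::nat. (real n) powr (- (2 * s))) summable_on (UNIV - {0})"
        by (rule summable_on_subset[OF sm]) simp
      show "wt (int n) powr - s \<le> (real n) powr (- (2 * s))" if "n \<in> UNIV - {0}" for n
        using le[of "int n"] that by simp
    qed simp
    then have "(\<lambda>n::nat. wt (int n) powr - s) summable_on (insert 0 (UNIV - {0}))"
      by (subst summable_on_insert_iff)
    then show ?thesis
      by (simp add: insert_Diff_if)
  qed
  have 1: "(\<lambda>k. wt k powr - s) summable_on range int"
    using pos by (subst summable_on_reindex) (auto simp: o_def)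
  have 2: "(\<lambda>k. wt k powr - s) summable_on range (\<lambda>n. - int n)"
    using pos by (subst summable_on_reindex) (auto simp: o_def wt_def inj_on_def)
  have "range int \<union> range (\<lambda>n. - int n) = UNIV"
  proof -
    have "k \<in> range int \<union> range (\<lambda>n. - int n)" for k
      by (cases k rule: int_cases2) auto
    then show ?thesis by blast
  qed
  then show ?thesis
    using summable_on_union[OF 1 2] by simp
qed

lemma Cauchy_Schwarz_infsum:
  fixes f g :: "'a \<Rightarrow> real"
  assumes f: "(\<lambda>x. (f x)\<^sup>2) summable_on A" and g: "(\<lambda>x. (g x)\<^sup>2) summable_on A"
  shows "(\<lambda>x. \<bar>f x * g x\<bar>) summable_on A"
    and "(\<Sum>\<^sub>\<infinity>x\<in>A. \<bar>f x * g x\<bar>) \<le> sqrt (\<Sum>\<^sub>\<infinity>x\<in>A. (f x)\<^sup>2) * sqrt (\<Sum>\<^sub>\<infinity>x\<in>A. (g x)\<^sup>2)"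
proof -
  have le: "(\<Sum>x\<in>F. \<bar>f x * g x\<bar>) \<le> sqrt (\<Sum>\<^sub>\<infinity>x\<in>A. (f x)\<^sup>2) * sqrt (\<Sum>\<^sub>\<infinity>x\<in>A. (g x)\<^sup>2)"
    if "finite F" "F \<subseteq> A" for F
  proof -
    have "(\<Sum>x\<in>F. \<bar>f x * g x\<bar>) \<le> L2_set f F * L2_set g F"
      using L2_set_mult_ineq[of f g F] by (simp add: abs_mult)
    also have "\<dots> \<le> sqrt (\<Sum>\<^sub>\<infinity>x\<in>A. (f x)\<^sup>2) * sqrt (\<Sum>\<^sub>\<infinity>x\<in>A. (g x)\<^sup>2)"
      unfolding L2_set_def using that
      by (intro mult_mono real_sqrt_le_mono finite_sum_le_infsum f g) (auto intro!: sum_nonneg infsum_nonneg)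
    finally show ?thesis .
  qed
  show *: "(\<lambda>x. \<bar>f x * g x\<bar>) summable_on A"
    by (rule nonneg_bdd_above_summable_on) (auto intro!: bdd_aboveI2 le)
  show "(\<Sum>\<^sub>\<infinity>x\<in>A. \<bar>f x * g x\<bar>) \<le> sqrt (\<Sum>\<^sub>\<infinity>x\<in>A. (f x)\<^sup>2) * sqrt (\<Sum>\<^sub>\<infinity>x\<in>A. (g x)\<^sup>2)"
    using * by (intro infsum_le_finite_sums le) auto
qed

text \<open>Sobolev embedding into absolutely convergent series: Cauchy--Schwarz after inserting
  \<open>wt k powr - (s / 2)\<close> and its inverse; the former is square summable because
  \<open>1 / 2 < s\<close>.\<close>

lemma in_h_imp_ell1:
  assumes "in_h s a" "1 / 2 < s"
  shows "ell1 a" and "(\<Sum>\<^sub>\<infinity>k. cmod (a k)) \<le> sqrt (\<Sum>\<^sub>\<infinity>k. wt k powr - s) * h_norm s a"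
proof -
  have *: "\<bar>wt k powr - (s / 2) * (wt k powr (s / 2) * cmod (a k))\<bar> = cmod (a k)" for k
    by (simp add: mult.assoc[symmetric] powr_add[symmetric])
  have 1: "(\<lambda>k. (wt k powr - (s / 2))\<^sup>2) summable_on UNIV"
    using assms(2) summable_wt_powr[of s] by (simp add: powr_power)
  have 2: "(\<lambda>k. (wt k powr (s / 2) * cmod (a k))\<^sup>2) summable_on UNIV"
    using assms(1) by (simp add: in_h_def weighted_square)
  show "ell1 a" "(\<Sum>\<^sub>\<infinity>k. cmod (a k)) \<le> sqrt (\<Sum>\<^sub>\<infinity>k. wt k powr - s) * h_norm s a"
    using Cauchy_Schwarz_infsum[OF 1 2] unfolding * by (simp_all add: h_norm_def weighted_square powr_power)
qed

section \<open>Convolution estimates\<close>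

definition conv :: "(int \<Rightarrow> complex) \<Rightarrow> (int \<Rightarrow> complex) \<Rightarrow> int \<Rightarrow> complex" where
  "conv a b k = (\<Sum>\<^sub>\<infinity>j. a (k - j) * b j)"

lemma bij_reflect: "bij (\<lambda>j. k - j :: int)"
  by (rule bij_betw_byWitness[where f' = "\<lambda>j. k - j"]) auto

lemma bij_shift: "bij (\<lambda>k. k - j :: int)"
  by (rule bij_betw_byWitness[where f' = "\<lambda>k. k + j"]) auto

lemma has_sum_sum:
  fixes f :: "'a \<Rightarrow> 'b \<Rightarrow> 'c :: topological_comm_monoid_add"
  assumes "finite F" "\<And>k. k \<in> F \<Longrightarrow> (f k has_sum s k) A"
  shows "((\<lambda>j. \<Sum>k\<in>F. f k j) has_sum (\<Sum>k\<in>F. s k)) A"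
  using assms by (induction F rule: finite_induct) (auto intro: has_sum_add)

text \<open>Cauchy--Schwarz for \<open>b\<close> and the reflected sequence
  \<open>a (k - j)\<close>, whose norm does not depend on \<open>k\<close>. Convergence of these
  sums justifies the bilinear algebra of \<open>conv\<close> below.\<close>

lemma conv_summable:
  assumes "in_h 0 a" "in_h 0 b"
  shows "(\<lambda>j. cmod (a (k - j) * b j)) summable_on UNIV"
    and "(\<lambda>j. a (k - j) * b j) summable_on UNIV"
    and "(\<Sum>\<^sub>\<infinity>j. cmod (a (k - j) * b j)) \<le> h_norm 0 a * h_norm 0 b"
    and "cmod (conv a b k) \<le> h_norm 0 a * h_norm 0 b"
proof -
  have a: "(\<lambda>j. (cmod (a (k - j)))\<^sup>2) summable_on UNIV"
    using assms(1) summable_on_reindex_bij_betw[OF bij_reflect, of "\<lambda>j. (cmod (a j))\<^sup>2" k]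
    by (simp add: in_h_def)
  have a': "(\<Sum>\<^sub>\<infinity>j. (cmod (a (k - j)))\<^sup>2) = (\<Sum>\<^sub>\<infinity>j. (cmod (a j))\<^sup>2)"
    by (rule infsum_reindex_bij_betw[OF bij_reflect])
  have b: "(\<lambda>j. (cmod (b j))\<^sup>2) summable_on UNIV"
    using assms(2) by (simp add: in_h_def)
  show 1: "(\<lambda>j. cmod (a (k - j) * b j)) summable_on UNIV"
    and 2: "(\<Sum>\<^sub>\<infinity>j. cmod (a (k - j) * b j)) \<le> h_norm 0 a * h_norm 0 b"
    using Cauchy_Schwarz_infsum[OF a b] by (simp_all add: norm_mult h_norm_def a')
  show "(\<lambda>j. a (k - j) * b j) summable_on UNIV"
    by (rule abs_summable_summable) (rule 1)
  show "cmod (conv a b k) \<le> h_norm 0 a * h_norm 0 b"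
    unfolding conv_def using norm_infsum_bound[OF 1] 2 by linarith
qed

lemma conv_commute: "conv a b k = conv b a k"
  unfolding conv_def
  by (rule infsum_reindex_bij_witness[of _ "\<lambda>j. k - j" "\<lambda>j. k - j"]) auto

lemma conv_add_right:
  assumes "in_h 0 a" "in_h 0 b" "in_h 0 c"
  shows "conv a (\<lambda>k. b k + c k) k = conv a b k + conv a c k"
  unfolding conv_def using assms
  by (simp add: distrib_left conv_summable(2) infsum_add)

lemma conv_cmult_right: "conv a (\<lambda>k. c * b k) k = c * conv a b k"
  unfolding conv_def infsum_cmult_right'[symmetric] by (simp add: mult_ac)

lemma conv_diff_right:
  assumes "in_h 0 a" "in_h 0 b" "in_h 0 c"
  shows "conv a (\<lambda>k. b k - c k) k = conv a b k - conv a c k"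
  using conv_add_right[of a b "\<lambda>k. - 1 * c k" k] conv_cmult_right[of a "- 1" c k] assms
  by (simp add: h_uminus)

text \<open>Commutativity cancels the mixed terms. The factorisation reduces continuity and
  Lipschitz bounds for the square to bounds for \<open>a - b\<close>.\<close>

lemma conv_diff_squares:
  assumes "in_h 0 a" "in_h 0 b"
  shows "conv a a k - conv b b k = conv (\<lambda>k. a k + b k) (\<lambda>k. a k - b k) k"
proof -
  have "conv (\<lambda>k. a k + b k) (\<lambda>k. a k - b k) k
      = conv a (\<lambda>k. a k + b k) k - conv b (\<lambda>k. a k + b k) k"
    using assms by (simp add: conv_diff_right h_add
        conv_commute[of "\<lambda>k. a k + b k" a] conv_commute[of "\<lambda>k. a k + b k" b])
  then show ?thesis
    using assms by (simp add: conv_add_right conv_commute[of b a])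
qed

lemma conv_ell1:
  assumes "ell1 a" "ell1 b"
  shows "ell1 (conv a b)" and "(\<Sum>\<^sub>\<infinity>k. conv a b k) = (\<Sum>\<^sub>\<infinity>k. a k) * (\<Sum>\<^sub>\<infinity>k. b k)"
proof -
  have shift: "(\<lambda>k. cmod (a (k - j))) summable_on UNIV"
    "(\<Sum>\<^sub>\<infinity>k. cmod (a (k - j))) = (\<Sum>\<^sub>\<infinity>k. cmod (a k))"
    "(\<Sum>\<^sub>\<infinity>k. a (k - j)) = (\<Sum>\<^sub>\<infinity>k. a k)" for j
    using assms(1) summable_on_reindex_bij_betw[OF bij_shift, of "\<lambda>k. cmod (a k)" j]
      infsum_reindex_bij_betw[OF bij_shift, of "\<lambda>k. cmod (a k)" j]
      infsum_reindex_bij_betw[OF bij_shift, of a j] by auto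
  \<comment> \<open>In this order the inner sum over \<open>k\<close> is a translate of
    \<open>a\<close>, so absolute summability can be read off; the order used in \<open>conv\<close>
    follows by swapping.\<close>
  have jk: "(\<lambda>p. norm (case p of (j, k) \<Rightarrow> a (k - j) * b j)) summable_on UNIV \<times> UNIV"
    by (rule Infinite_Sum.abs_summable_on_Sigma_iff[THEN iffD2])
      (use assms shift in \<open>auto simp: norm_mult infsum_cmult_left' abs_mult infsum_nonneg
        intro!: summable_on_cmult_left summable_on_cmult_right\<close>)
  have kj: "(\<lambda>p. norm (case p of (k, j) \<Rightarrow> a (k - j) * b j)) summable_on UNIV \<times> UNIV"
    using jk by (subst summable_on_swap) (simp add: case_prod_unfold)
  have in1: "(\<lambda>j. cmod (a (k - j) * b j)) summable_on UNIV" for k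
    using kj unfolding Infinite_Sum.abs_summable_on_Sigma_iff by auto
  have out1: "(\<lambda>k. \<Sum>\<^sub>\<infinity>j. cmod (a (k - j) * b j)) summable_on UNIV"
    using kj unfolding Infinite_Sum.abs_summable_on_Sigma_iff by (auto simp: infsum_nonneg)
  show "ell1 (conv a b)"
    by (rule summable_on_comparison_test[OF out1])
      (auto simp: conv_def intro!: norm_infsum_bound in1)
  have "(\<Sum>\<^sub>\<infinity>k. conv a b k) = (\<Sum>\<^sub>\<infinity>j. \<Sum>\<^sub>\<infinity>k. a (k - j) * b j)"
    unfolding conv_def
    by (rule infsum_swap_banach) (use abs_summable_summable[OF kj] in \<open>simp add: case_prod_unfold\<close>)
  also have "\<dots> = (\<Sum>\<^sub>\<infinity>k. a k) * (\<Sum>\<^sub>\<infinity>k. b k)"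
    by (simp add: infsum_cmult_left' infsum_cmult_right' shift)
  finally show "(\<Sum>\<^sub>\<infinity>k. conv a b k) = (\<Sum>\<^sub>\<infinity>k. a k) * (\<Sum>\<^sub>\<infinity>k. b k)" .
qed

text \<open>The larger of the two weights is at least \<open>wt k / 4\<close>, so its power absorbs
  \<open>wt k powr p\<close>. If \<open>wt (k - j)\<close> is the larger one, its power
  \<open>p - s \<le> 0\<close> is left over, which is at most the same power of the smaller
  weight.\<close>

lemma wt_kernel:
  assumes "0 \<le> p" "p \<le> s"
  shows "wt k powr p * wt (k - j) powr - s * wt j powr - p \<le> 4 powr p * (wt (k - j) powr - s + wt j powr - s)"
proof -
  have gen: "wt k powr p * x powr - s * y powr - p \<le> 4 powr p * (x powr - s + y powr - s)"
    if "wt k \<le> 2 * (x + y)" "0 < x" "0 < y" for x y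
  proof (cases "x \<le> y")
    case True
    have "wt k powr p \<le> (4 * y) powr p"
      using that True assms by (intro powr_mono2) auto
    also have "\<dots> = 4 powr p * y powr p"
      using that by (simp add: powr_mult)
    finally have "wt k powr p * (x powr - s * y powr - p)
        \<le> 4 powr p * y powr p * (x powr - s * y powr - p)"
      by (intro mult_right_mono) auto
    also have "\<dots> = 4 powr p * x powr - s"
      using that by (simp add: powr_minus)
    also have "\<dots> \<le> 4 powr p * (x powr - s + y powr - s)"
      by simp
    finally show ?thesis by (simp add: mult.assoc)
  next
    case False
    have "wt k powr p \<le> (4 * x) powr p"
      using that False assms by (intro powr_mono2) auto
    also have "\<dots> = 4 powr p * x powr p"
      using that by (simp add: powr_mult)
    finally have "wt k powr p * (x powr - s * y powr - p)
        \<le> 4 powr p * x powr p * (x powr - s * y powr - p)"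
      by (intro mult_right_mono) auto
    also have "\<dots> = 4 powr p * (x powr (p - s) * y powr - p)"
      by (simp add: powr_add[symmetric] mult.assoc[symmetric])
    also have "\<dots> \<le> 4 powr p * (y powr (p - s) * y powr - p)"
      using that False assms by (intro mult_left_mono mult_right_mono powr_mono2') auto
    also have "\<dots> \<le> 4 powr p * (x powr - s + y powr - s)"
      by (simp add: powr_add[symmetric])
    finally show ?thesis by (simp add: mult.assoc)
  qed
  show ?thesis
    by (rule gen[OF wt_le_sum]) simp_all
qed

text \<open>Weighted Cauchy--Schwarz for a single coefficient: each term is split into a kernel
  \<open>f\<close> made of weights and the weighted entries \<open>g\<close>. By
  \<open>wt_kernel\<close> the kernel is square summable uniformly in \<open>k\<close>, since a
  reflected copy of the weights has the same sum \<open>S\<close>.\<close>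

lemma h_conv_aux:
  assumes s: "1 / 2 < s" and p: "0 \<le> p" "p \<le> s"
    and a: "in_h s a" and b: "in_h p b"
  defines "S \<equiv> (\<Sum>\<^sub>\<infinity>k. wt k powr - s)"
  shows "(wt k powr (p / 2) * cmod (conv a b k))\<^sup>2 \<le> 2 * 4 powr p * S *
    (\<Sum>\<^sub>\<infinity>j. (wt (k - j) powr s * (cmod (a (k - j)))\<^sup>2) * (wt j powr p * (cmod (b j))\<^sup>2))"
    and "(\<lambda>j. (wt (k - j) powr s * (cmod (a (k - j)))\<^sup>2) * (wt j powr p * (cmod (b j))\<^sup>2)) summable_on UNIV"
proof -
  define f where "f j = wt k powr (p / 2) * wt (k - j) powr - (s / 2) * wt j powr - (p / 2)" for j
  define g where "g j = wt (k - j) powr (s / 2) * cmod (a (k - j)) * (wt j powr (p / 2) * cmod (b j))" for j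
  have fg: "f j * g j = wt k powr (p / 2) * cmod (a (k - j) * b j)" for j
  proof -
    have "wt j powr - (p / 2) * wt j powr (p / 2) = 1"
      "wt (k - j) powr - (s / 2) * wt (k - j) powr (s / 2) = 1"
      by (simp_all add: powr_add[symmetric])
    moreover have "f j * g j = wt k powr (p / 2) * (wt j powr - (p / 2) * wt j powr (p / 2)) *
        (wt (k - j) powr - (s / 2) * wt (k - j) powr (s / 2)) * cmod (a (k - j) * b j)"
      by (simp only: f_def g_def norm_mult mult_ac)
    ultimately show ?thesis by simp
  qed
  have f2: "(f j)\<^sup>2 = wt k powr p * wt (k - j) powr - s * wt j powr - p" for j
    by (simp add: f_def power_mult_distrib powr_power)
  have g2: "(g j)\<^sup>2 = (wt (k - j) powr s * (cmod (a (k - j)))\<^sup>2) * (wt j powr p * (cmod (b j))\<^sup>2)" for j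
    by (simp add: g_def power_mult_distrib powr_power)
  have w1: "(\<lambda>j. wt j powr - s) summable_on UNIV"
    using summable_wt_powr[OF s] .
  have w2: "(\<lambda>j. wt (k - j) powr - s) summable_on UNIV"
    using w1 summable_on_reindex_bij_betw[OF bij_reflect, of "\<lambda>j. wt j powr - s" k] by simp
  have w3: "(\<Sum>\<^sub>\<infinity>j. wt (k - j) powr - s) = S"
    unfolding S_def by (rule infsum_reindex_bij_betw[OF bij_reflect])
  have w: "(\<lambda>j. 4 powr p * (wt (k - j) powr - s + wt j powr - s)) summable_on UNIV"
    by (intro summable_on_cmult_right summable_on_add w1 w2)
  have fs: "(\<lambda>j. (f j)\<^sup>2) summable_on UNIV"
    by (rule summable_on_comparison_test[OF w]) (auto simp: f2 intro!: wt_kernel p)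
  have fS: "(\<Sum>\<^sub>\<infinity>j. (f j)\<^sup>2) \<le> 2 * 4 powr p * S"
  proof -
    have "(\<Sum>\<^sub>\<infinity>j. (f j)\<^sup>2) \<le> (\<Sum>\<^sub>\<infinity>j. 4 powr p * (wt (k - j) powr - s + wt j powr - s))"
      by (rule infsum_mono[OF fs w]) (auto simp: f2 intro!: wt_kernel p)
    also have "\<dots> = 4 powr p * (S + S)"
      by (simp add: infsum_cmult_right' infsum_add w1 w2 w3 S_def[symmetric])
    finally show ?thesis by simp
  qed
  have bs: "(\<lambda>j. wt j powr p * (cmod (b j))\<^sup>2) summable_on UNIV"
    using b by (simp add: in_h_def)
  have gs: "(\<lambda>j. (g j)\<^sup>2) summable_on UNIV"
  proof (rule summable_on_comparison_test)
    show "(\<lambda>j. (h_norm s a)\<^sup>2 * (wt j powr p * (cmod (b j))\<^sup>2)) summable_on UNIV"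
      by (intro summable_on_cmult_right bs)
    fix j
    have "(wt (k - j) powr (s / 2) * cmod (a (k - j)))\<^sup>2 \<le> (h_norm s a)\<^sup>2"
      by (intro power_mono h_point_le a) simp
    then show "(g j)\<^sup>2 \<le> (h_norm s a)\<^sup>2 * (wt j powr p * (cmod (b j))\<^sup>2)"
      unfolding g2 weighted_square by (intro mult_right_mono) auto
  qed simp
  then show "(\<lambda>j. (wt (k - j) powr s * (cmod (a (k - j)))\<^sup>2) * (wt j powr p * (cmod (b j))\<^sup>2)) summable_on UNIV"
    by (simp add: g2)
  have ab: "in_h 0 a" "in_h 0 b"
    using h_embed(1)[OF a, of 0] h_embed(1)[OF b, of 0] p s by auto
  have "wt k powr (p / 2) * cmod (conv a b k) \<le> wt k powr (p / 2) * (\<Sum>\<^sub>\<infinity>j. cmod (a (k - j) * b j))"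
    unfolding conv_def by (intro mult_left_mono norm_infsum_bound conv_summable ab) simp
  also have "\<dots> = (\<Sum>\<^sub>\<infinity>j. \<bar>f j * g j\<bar>)"
    by (simp add: fg infsum_cmult_right' abs_mult)
  also have "\<dots> \<le> sqrt (\<Sum>\<^sub>\<infinity>j. (f j)\<^sup>2) * sqrt (\<Sum>\<^sub>\<infinity>j. (g j)\<^sup>2)"
    by (rule Cauchy_Schwarz_infsum[OF fs gs])
  finally have "(wt k powr (p / 2) * cmod (conv a b k))\<^sup>2
      \<le> (sqrt (\<Sum>\<^sub>\<infinity>j. (f j)\<^sup>2) * sqrt (\<Sum>\<^sub>\<infinity>j. (g j)\<^sup>2))\<^sup>2"
    by (intro power_mono) auto
  also have "\<dots> = (\<Sum>\<^sub>\<infinity>j. (f j)\<^sup>2) * (\<Sum>\<^sub>\<infinity>j. (g j)\<^sup>2)"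
    by (simp add: power_mult_distrib infsum_nonneg)
  also have "\<dots> \<le> 2 * 4 powr p * S * (\<Sum>\<^sub>\<infinity>j. (g j)\<^sup>2)"
    by (intro mult_right_mono fS infsum_nonneg) simp
  finally show "(wt k powr (p / 2) * cmod (conv a b k))\<^sup>2 \<le> 2 * 4 powr p * S *
    (\<Sum>\<^sub>\<infinity>j. (wt (k - j) powr s * (cmod (a (k - j)))\<^sup>2) * (wt j powr p * (cmod (b j))\<^sup>2))"
    by (simp only: g2)
qed

text \<open>Square root of the constant in \<open>h_conv_aux\<close>. It depends on the two orders
  only, so the final constant can be fixed before \<open>\<epsilon>\<close> is given.\<close>

definition conv_bound :: "real \<Rightarrow> real \<Rightarrow> real" where
  "conv_bound s p = sqrt (2 * 4 powr p * (\<Sum>\<^sub>\<infinity>k. wt k powr - s))"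

lemma conv_bound_nonneg [simp]: "0 \<le> conv_bound s p"
  by (simp add: conv_bound_def infsum_nonneg)

text \<open>Summing the coefficientwise bound over \<open>k\<close> leads to the convolution of the
  summable sequences \<open>G\<close> and \<open>H\<close>, which is bounded by the product of their
  sums.\<close>

lemma h_conv:
  assumes s: "1 / 2 < s" and p: "0 \<le> p" "p \<le> s"
    and a: "in_h s a" and b: "in_h p b"
  shows "in_h p (conv a b)" and "h_norm p (conv a b) \<le> conv_bound s p * h_norm s a * h_norm p b"
proof -
  define C where "C = conv_bound s p"
  define G where "G k = wt k powr s * (cmod (a k))\<^sup>2" for k
  define H where "H k = wt k powr p * (cmod (b k))\<^sup>2" for k
  have C2: "C\<^sup>2 = 2 * 4 powr p * (\<Sum>\<^sub>\<infinity>k. wt k powr - s)"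
    unfolding C_def conv_bound_def by (simp add: infsum_nonneg)
  have C0: "0 \<le> C"
    unfolding C_def by simp
  have *: "h_part p (conv a b) F \<le> C * h_norm s a * h_norm p b" if F: "finite F" for F
  proof (rule power2_le_imp_le)
    have "(h_part p (conv a b) F)\<^sup>2 = (\<Sum>k\<in>F. (wt k powr (p / 2) * cmod (conv a b k))\<^sup>2)"
      unfolding h_part_square weighted_square ..
    also have "\<dots> \<le> (\<Sum>k\<in>F. C\<^sup>2 * (\<Sum>\<^sub>\<infinity>j. G (k - j) * H j))"
      unfolding C2 G_def H_def by (intro sum_mono h_conv_aux s p a b)
    also have "\<dots> = C\<^sup>2 * (\<Sum>k\<in>F. \<Sum>\<^sub>\<infinity>j. G (k - j) * H j)"
      by (simp add: sum_distrib_left)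
    also have "(\<Sum>k\<in>F. \<Sum>\<^sub>\<infinity>j. G (k - j) * H j) \<le> (h_norm s a)\<^sup>2 * (h_norm p b)\<^sup>2"
    proof (rule has_sum_mono)
      show "((\<lambda>j. \<Sum>k\<in>F. G (k - j) * H j) has_sum (\<Sum>k\<in>F. \<Sum>\<^sub>\<infinity>j. G (k - j) * H j)) UNIV"
        unfolding G_def H_def by (intro has_sum_sum F has_sum_infsum h_conv_aux s p a b)
      show "((\<lambda>j. (h_norm s a)\<^sup>2 * H j) has_sum (h_norm s a)\<^sup>2 * (h_norm p b)\<^sup>2) UNIV"
        unfolding H_def h_norm_square[of p]
        using b by (intro has_sum_cmult_right has_sum_infsum) (simp add: in_h_def)
      fix j
      \<comment> \<open>For fixed \<open>j\<close> this is a finite section of \<open>G\<close>,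
        shifted by \<open>j\<close>.\<close>
      have "(\<Sum>k\<in>F. G (k - j)) = sum G ((\<lambda>k. k - j) ` F)"
        by (subst sum.reindex) (auto simp: inj_on_def)
      also have "\<dots> \<le> (h_norm s a)\<^sup>2"
        unfolding h_norm_square G_def using a F
        by (intro finite_sum_le_infsum) (auto simp: in_h_def)
      finally show "(\<Sum>k\<in>F. G (k - j) * H j) \<le> (h_norm s a)\<^sup>2 * H j"
        unfolding sum_distrib_right[symmetric] by (intro mult_right_mono) (auto simp: H_def)
    qed
    finally show "(h_part p (conv a b) F)\<^sup>2 \<le> (C * h_norm s a * h_norm p b)\<^sup>2"
      by (simp add: power_mult_distrib mult.assoc mult_left_mono)
  qed (simp add: C0)
  show "in_h p (conv a b)" and "h_norm p (conv a b) \<le> conv_bound s p * h_norm s a * h_norm p b"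
    using in_hI[OF *] by (auto simp: C_def)
qed

definition lossy_conv_bound :: "real \<Rightarrow> real" where
  "lossy_conv_bound r = 2 powr (r / 2) * sqrt (\<Sum>\<^sub>\<infinity>k. wt k powr - 1)"

lemma lossy_conv_bound_nonneg [simp]: "0 \<le> lossy_conv_bound r"
  by (simp add: lossy_conv_bound_def infsum_nonneg)

text \<open>This covers every \<open>r \<ge> 0\<close>, also orders at which H^r is not an algebra.
  By \<open>wt_le_prod\<close> the weight passes to both factors, Cauchy--Schwarz makes the weighted
  convolution a bounded sequence, and bounded sequences lie in H^(-1).\<close>

lemma h_conv_lossy:
  assumes r: "0 \<le> r" and a: "in_h r a" and b: "in_h r b"
  shows "in_h (r - 1) (conv a b)" and "h_norm (r - 1) (conv a b) \<le> lossy_conv_bound r * h_norm r a * h_norm r b"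
proof -
  define \<alpha> where "\<alpha> k = of_real (wt k powr (r / 2)) * a k" for k
  define \<beta> where "\<beta> k = of_real (wt k powr (r / 2)) * b k" for k
  have \<alpha>: "in_h 0 \<alpha>" "h_norm 0 \<alpha> \<le> h_norm r a"
    using h_dominated[OF a, of 1 0 \<alpha>] by (auto simp: \<alpha>_def norm_mult)
  have \<beta>: "in_h 0 \<beta>" "h_norm 0 \<beta> \<le> h_norm r b"
    using h_dominated[OF b, of 1 0 \<beta>] by (auto simp: \<beta>_def norm_mult)
  have ab: "in_h 0 a" "in_h 0 b"
    using h_embed(1)[OF a, of 0] h_embed(1)[OF b, of 0] r by auto
  define D where "D = 2 powr (r / 2) * (h_norm r a * h_norm r b)"
  have D: "0 \<le> D"
    by (simp add: D_def)
  have pt: "wt k powr (r / 2) * cmod (conv a b k) \<le> D" for k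
  proof -
    have "wt k powr (r / 2) * cmod (conv a b k)
        \<le> wt k powr (r / 2) * (\<Sum>\<^sub>\<infinity>j. cmod (a (k - j) * b j))"
      unfolding conv_def by (intro mult_left_mono norm_infsum_bound conv_summable ab) simp
    also have "\<dots> = (\<Sum>\<^sub>\<infinity>j. wt k powr (r / 2) * cmod (a (k - j) * b j))"
      by (simp add: infsum_cmult_right')
    also have "\<dots> \<le> (\<Sum>\<^sub>\<infinity>j. 2 powr (r / 2) * cmod (\<alpha> (k - j) * \<beta> j))"
    proof (rule infsum_mono)
      fix j
      have "wt k powr (r / 2) \<le> (2 * (wt (k - j) * wt j)) powr (r / 2)"
        using r by (intro powr_mono2 wt_le_prod) auto
      also have "\<dots> = 2 powr (r / 2) * (wt (k - j) powr (r / 2) * wt j powr (r / 2))"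
        by (simp add: powr_mult)
      finally have "wt k powr (r / 2) * cmod (a (k - j) * b j)
          \<le> 2 powr (r / 2) * (wt (k - j) powr (r / 2) * wt j powr (r / 2)) * cmod (a (k - j) * b j)"
        by (intro mult_right_mono) auto
      also have "\<dots> = 2 powr (r / 2) * cmod (\<alpha> (k - j) * \<beta> j)"
        by (simp add: \<alpha>_def \<beta>_def norm_mult mult_ac)
      finally show "wt k powr (r / 2) * cmod (a (k - j) * b j) \<le> 2 powr (r / 2) * cmod (\<alpha> (k - j) * \<beta> j)" .
    qed (intro summable_on_cmult_right conv_summable ab \<alpha> \<beta>)+
    also have "\<dots> = 2 powr (r / 2) * (\<Sum>\<^sub>\<infinity>j. cmod (\<alpha> (k - j) * \<beta> j))"
      by (simp add: infsum_cmult_right')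
    also have "\<dots> \<le> 2 powr (r / 2) * (h_norm 0 \<alpha> * h_norm 0 \<beta>)"
      by (intro mult_left_mono conv_summable \<alpha> \<beta>) simp
    also have "\<dots> \<le> D"
      unfolding D_def by (intro mult_left_mono mult_mono \<alpha> \<beta>) auto
    finally show ?thesis .
  qed
  \<comment> \<open>The constant sequence serves as majorant; its norm is the second factor of
    \<open>lossy_conv_bound\<close>.\<close>
  have w: "in_h (- 1) (\<lambda>k. 1)" "h_norm (- 1) (\<lambda>k. 1) = sqrt (\<Sum>\<^sub>\<infinity>k. wt k powr - 1)"
    using summable_wt_powr[of 1] by (simp_all add: in_h_def h_norm_def)
  have "wt k powr ((r - 1) / 2) * cmod (conv a b k) \<le> D * (wt k powr (- 1 / 2) * cmod 1)" for k
  proof -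
    have "wt k powr ((r - 1) / 2) * cmod (conv a b k)
        = wt k powr (- 1 / 2) * (wt k powr (r / 2) * cmod (conv a b k))"
      by (simp add: mult.assoc[symmetric] powr_add[symmetric] diff_divide_distrib)
    also have "\<dots> \<le> wt k powr (- 1 / 2) * D"
      by (intro mult_left_mono pt) simp
    finally show ?thesis by (simp add: mult.commute)
  qed
  from h_dominated[OF w(1) D this]
  show "in_h (r - 1) (conv a b)" "h_norm (r - 1) (conv a b) \<le> lossy_conv_bound r * h_norm r a * h_norm r b"
    unfolding w(2) by (simp_all add: lossy_conv_bound_def D_def mult_ac)
qed

section \<open>Absolutely convergent Fourier series\<close>

definition tser :: "(int \<Rightarrow> complex) \<Rightarrow> real \<Rightarrow> complex" where
  "tser a x = (\<Sum>\<^sub>\<infinity>k. a k * exp (\<i> * of_int k * of_real x))"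

lemma norm_character [simp]: "cmod (exp (\<i> * of_int k * of_real x)) = 1"
  by (simp add: norm_exp_eq_Re)

text \<open>Symmetric intervals are cofinal among the finite sets of integers. Unordered sums thus
  become limits of sequences, as dominated convergence and measurability of limits require.\<close>

lemma symmetric_partial_sums_tendsto:
  fixes f :: "int \<Rightarrow> 'a :: real_normed_vector"
  assumes "f summable_on UNIV"
  shows "(\<lambda>n. \<Sum>k\<in>{- int n..int n}. f k) \<longlonglongrightarrow> (\<Sum>\<^sub>\<infinity>k. f k)"
proof -
  have lim: "filterlim (\<lambda>n. {- int n..int n}) (finite_subsets_at_top UNIV) sequentially"
    unfolding filterlim_finite_subsets_at_top
  proof (intro allI impI)
    fix X :: "int set" assume X: "finite X \<and> X \<subseteq> UNIV"
    define N where "N = nat (\<Sum>k\<in>X. \<bar>k\<bar>)"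
    have "X \<subseteq> {- int n..int n}" if "N \<le> n" for n
    proof
      fix k assume "k \<in> X"
      then have "\<bar>k\<bar> \<le> (\<Sum>k\<in>X. \<bar>k\<bar>)"
        using X by (intro member_le_sum) auto
      then show "k \<in> {- int n..int n}"
        using that unfolding N_def by auto
    qed
    then show "\<forall>\<^sub>F n in sequentially. finite {- int n..int n} \<and> X \<subseteq> {- int n..int n} \<and> {- int n..int n} \<subseteq> UNIV"
      by (intro eventually_sequentiallyI[of N] conjI) simp_all
  qed
  show ?thesis
    using filterlim_compose[OF infsum_tendsto[OF assms] lim] .
qed

lemma tser_summable:
  assumes "ell1 a"
  shows "(\<lambda>k. a k * exp (\<i> * of_int k * of_real x)) summable_on UNIV"
  by (rule abs_summable_summable) (use assms in \<open>simp add: norm_mult\<close>)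

lemma tser_tendsto:
  assumes "ell1 a"
  shows "(\<lambda>n. \<Sum>k\<in>{- int n..int n}. a k * exp (\<i> * of_int k * of_real x)) \<longlonglongrightarrow> tser a x"
  unfolding tser_def by (intro symmetric_partial_sums_tendsto tser_summable assms)

lemma ell1_partial_sum_le:
  assumes "ell1 a" "finite F"
  shows "cmod (\<Sum>k\<in>F. a k * exp (\<i> * of_int k * of_real x)) \<le> (\<Sum>\<^sub>\<infinity>k. cmod (a k))"
proof -
  have "cmod (\<Sum>k\<in>F. a k * exp (\<i> * of_int k * of_real x)) \<le> (\<Sum>k\<in>F. cmod (a k))"
    by (rule sum_norm_le) (simp add: norm_mult)
  also have "\<dots> \<le> (\<Sum>\<^sub>\<infinity>k. cmod (a k))"
    using assms by (intro finite_sum_le_infsum) auto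
  finally show ?thesis .
qed

lemma norm_tser_le:
  assumes "ell1 a"
  shows "cmod (tser a x) \<le> (\<Sum>\<^sub>\<infinity>k. cmod (a k))"
  using norm_infsum_bound[of "\<lambda>k. a k * exp (\<i> * of_int k * of_real x)" UNIV] assms
  by (simp add: tser_def norm_mult)

section \<open>Integration over the torus and orthogonality of characters\<close>

lemma measurable_torusI:
  assumes "f \<in> borel_measurable borel"
  shows "f \<in> borel_measurable torus"
proof (rule measurable_restrict_space1)
  show "f \<in> borel_measurable lebesgue"
    using assms by (intro measurable_completion) simp
qed

lemma tser_measurable:
  assumes "ell1 a"
  shows "tser a \<in> borel_measurable torus"
proof (rule measurable_torusI, rule borel_measurable_LIMSEQ_metric)
  show "(\<lambda>x. \<Sum>k\<in>{- int n..int n}. a k * exp (\<i> * of_int k * of_real x)) \<in> borel_measurable borel" for n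
    by (intro borel_measurable_continuous_onI continuous_intros)
  show "(\<lambda>n. \<Sum>k\<in>{- int n..int n}. a k * exp (\<i> * of_int k * of_real x)) \<longlonglongrightarrow> tser a x" for x
    by (rule tser_tendsto[OF assms])
qed

interpretation torus: finite_measure torus
  by (rule finite_measure_lebesgue_on) simp

lemma integral_character:
  "(LINT x|torus. exp (\<i> * of_int m * of_real x)) = (if m = 0 then 2 * of_real pi else 0)"
proof -
  have "integrable torus (\<lambda>x. exp (\<i> * of_int m * of_real x))"
    by (rule torus.integrable_const_bound[where B = 1])
      (auto intro!: measurable_torusI borel_measurable_continuous_onI continuous_intros)
  then have eq: "(LINT x|torus. exp (\<i> * of_int m * of_real x))
      = integral {-pi..pi} (\<lambda>x. exp (\<i> * of_int m * of_real x))"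
    by (rule lebesgue_integral_eq_integral) simp
  show ?thesis
  proof (cases "m = 0")
    case True
    then show ?thesis
      unfolding eq by (simp add: scaleR_conv_of_real)
  next
    case False
    define G where "G x = exp (\<i> * of_int m * of_real x) / (\<i> * of_int m)" for x :: real
    have "((\<lambda>x. exp (\<i> * of_int m * of_real x)) has_integral (G pi - G (-pi))) {-pi..pi}"
    proof (rule fundamental_theorem_of_calculus)
      fix x assume "x \<in> {-pi..pi}"
      have "((\<lambda>z. exp (\<i> * of_int m * z) / (\<i> * of_int m)) has_field_derivative
          exp (\<i> * of_int m * of_real x)) (at (of_real x))"
        using False by (auto intro!: derivative_eq_intros)
      then show "(G has_vector_derivative exp (\<i> * of_int m * of_real x)) (at x within {-pi..pi})"
        unfolding G_def by (rule has_vector_derivative_real_field)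
    qed simp
    \<comment> \<open>The two exponents differ by 2 pi i m, so the antiderivative has equal end
      point values.\<close>
    moreover have "G pi = G (-pi)"
    proof -
      have "exp (\<i> * of_int m * of_real pi) = exp (\<i> * of_int m * of_real (-pi))"
        by (subst exp_eq) (auto intro!: exI[of _ m])
      then show ?thesis by (simp add: G_def)
    qed
    ultimately show ?thesis
      unfolding eq using False by (simp add: integral_unique)
  qed
qed

text \<open>Dominated convergence, with the sum of the moduli as majorant, reduces the integral to
  symmetric partial sums, where orthogonality leaves the term \<open>j = k\<close> alone.\<close>

lemma fourier_coeff_tser:
  assumes "ell1 a"
  shows "fourier_coeff (tser a) k = a k"
proof -
  define e where "e m x = exp (\<i> * of_int m * of_real x)" for m :: int and x :: real
  define p where "p n x = (\<Sum>j\<in>{- int n..int n}. a j * e j x) * e (- k) x" for n x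
  define M where "M = (\<Sum>\<^sub>\<infinity>k. cmod (a k))"
  have [measurable]: "e m \<in> borel_measurable torus" for m
    unfolding e_def by (intro measurable_torusI borel_measurable_continuous_onI continuous_intros)
  have int_e: "integrable torus (e m)" for m
    by (rule torus.integrable_const_bound[where B = 1]) (auto simp: e_def)
  have "(\<lambda>n. LINT x|torus. p n x) \<longlonglongrightarrow> (LINT x|torus. tser a x * e (- k) x)"
  proof (rule integral_dominated_convergence[where w = "\<lambda>_. M"])
    show "(\<lambda>x. tser a x * e (- k) x) \<in> borel_measurable torus"
      by (intro borel_measurable_times tser_measurable assms) simp
    show "p n \<in> borel_measurable torus" for n
      unfolding p_def by measurable
    show "AE x in torus. (\<lambda>n. p n x) \<longlonglongrightarrow> tser a x * e (- k) x"
      unfolding p_def e_def by (intro AE_I2 tendsto_mult tser_tendsto assms tendsto_const)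
    show "AE x in torus. norm (p n x) \<le> M" for n
    proof (rule AE_I2)
      show "norm (p n x) \<le> M" for x
        using ell1_partial_sum_le[OF assms, of "{- int n..int n}" x]
          norm_character[of "- k" x] by (simp add: p_def e_def M_def norm_mult)
    qed
  qed simp
  \<comment> \<open>Once the range contains \<open>k\<close>, the integrals no longer change, so
    their limit is known.\<close>
  moreover have "(LINT x|torus. p n x) = 2 * of_real pi * a k" if "nat \<bar>k\<bar> \<le> n" for n
  proof -
    have "p n x = (\<Sum>j\<in>{- int n..int n}. a j * e (j - k) x)" for x
      unfolding p_def sum_distrib_right
      by (intro sum.cong refl) (simp add: e_def mult_exp_exp algebra_simps)
    then have "(LINT x|torus. p n x) = (\<Sum>j\<in>{- int n..int n}. a j * (LINT x|torus. e (j - k) x))"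
      using int_e by simp
    also have "\<dots> = (\<Sum>j\<in>{- int n..int n}. if j = k then 2 * of_real pi * a k else 0)"
      unfolding e_def integral_character by (intro sum.cong) auto
    also have "\<dots> = 2 * of_real pi * a k"
      using that by (subst sum.delta) auto
    finally show ?thesis .
  qed
  then have "(\<lambda>n. LINT x|torus. p n x) \<longlonglongrightarrow> 2 * of_real pi * a k"
    by (intro tendsto_eventually) (auto simp: eventually_sequentially)
  ultimately have "(LINT x|torus. tser a x * e (- k) x) = 2 * of_real pi * a k"
    by (rule LIMSEQ_unique)
  then show ?thesis
    by (simp add: fourier_coeff_def e_def)
qed

lemma tser_linear:
  assumes "ell1 a" "ell1 b"
  shows "tser (\<lambda>k. a k + c * b k) x = tser a x + c * tser b x"
proof -
  have "tser (\<lambda>k. a k + c * b k) x = (\<Sum>\<^sub>\<infinity>k. a k * exp (\<i> * of_int k * of_real x)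
      + c * (b k * exp (\<i> * of_int k * of_real x)))"
    by (simp add: tser_def algebra_simps)
  also have "\<dots> = tser a x + c * tser b x"
    unfolding tser_def
    by (simp add: infsum_add tser_summable assms summable_on_cmult_right infsum_cmult_right')
  finally show ?thesis .
qed

lemma ell1_linear:
  assumes "ell1 a" "ell1 b"
  shows "ell1 (\<lambda>k. a k + c * b k)"
proof (rule summable_on_comparison_test)
  show "(\<lambda>k. cmod (a k) + cmod c * cmod (b k)) summable_on UNIV"
    by (intro summable_on_add summable_on_cmult_right assms)
  show "cmod (a k + c * b k) \<le> cmod (a k) + cmod c * cmod (b k)" for k
    by (metis norm_triangle_ineq norm_mult)
qed simp

text \<open>Evaluation at \<open>x\<close> twists the coefficients by a character. Since
  \<open>e (k - j) * e j = e k\<close>, the twist commutes with convolution, and the product formula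
  of \<open>conv_ell1\<close> applies to the twisted sequences.\<close>

lemma tser_mult:
  assumes "ell1 a" "ell1 b"
  shows "tser a x * tser b x = tser (conv a b) x"
proof -
  define e where "e k = exp (\<i> * of_int k * of_real x)" for k :: int
  have [simp]: "cmod (e k) = 1" for k
    by (simp add: e_def)
  have "conv (\<lambda>k. a k * e k) (\<lambda>k. b k * e k) k = conv a b k * e k" for k
  proof -
    have "e (k - j) * e j = e k" for j
      by (simp add: e_def mult_exp_exp algebra_simps)
    then have eq: "a (k - j) * e (k - j) * (b j * e j) = a (k - j) * b j * e k" for j
      by (metis (no_types, lifting) mult.assoc mult.left_commute)
    show ?thesis
      unfolding conv_def infsum_cmult_left'[symmetric] eq ..
  qed
  then show ?thesis
    using conv_ell1(2)[of "\<lambda>k. a k * e k" "\<lambda>k. b k * e k"] assms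
    by (simp add: tser_def norm_mult flip: e_def)
qed

text \<open>The dictionary between functions and sequences. Equality is required almost everywhere
  only, because \<open>mild_solution\<close> provides no more; the function still determines its
  coefficients.\<close>

definition series_rep :: "(real \<Rightarrow> complex) \<Rightarrow> (int \<Rightarrow> complex) \<Rightarrow> bool" where
  "series_rep f a \<longleftrightarrow> ell1 a \<and> f \<in> borel_measurable torus \<and> (AE x in torus. f x = tser a x)"

lemma series_rep_coeff:
  assumes "series_rep f a"
  shows "fourier_coeff f = a"
proof
  fix k
  have a: "ell1 a" and f [measurable]: "f \<in> borel_measurable torus"
    and ae: "AE x in torus. f x = tser a x"
    using assms by (auto simp: series_rep_def)
  have [measurable]: "tser a \<in> borel_measurable torus"
    by (rule tser_measurable[OF a])
  have [measurable]: "(\<lambda>x. exp (- (\<i> * of_int k * of_real x))) \<in> borel_measurable torus"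
    by (intro measurable_torusI borel_measurable_continuous_onI continuous_intros)
  have "fourier_coeff f k = fourier_coeff (tser a) k"
    unfolding fourier_coeff_def using ae
    by (intro arg_cong2[where f = "(/)"] integral_cong_AE refl) auto
  then show "fourier_coeff f k = a k"
    by (simp add: fourier_coeff_tser[OF a])
qed

text \<open>The series is bounded by the sum of the moduli, and the torus has finite
  measure.\<close>

lemma series_rep_square_integrable:
  assumes "series_rep f a"
  shows "integrable torus (\<lambda>x. (cmod (f x))\<^sup>2)"
proof (rule torus.integrable_const_bound)
  have ae: "AE x in torus. f x = tser a x" and a: "ell1 a" and m: "f \<in> borel_measurable torus"
    using assms by (auto simp: series_rep_def)
  from ae show "AE x in torus. norm ((cmod (f x))\<^sup>2) \<le> (\<Sum>\<^sub>\<infinity>k. cmod (a k))\<^sup>2"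
  proof (rule eventually_mono)
    fix x assume "f x = tser a x"
    then show "norm ((cmod (f x))\<^sup>2) \<le> (\<Sum>\<^sub>\<infinity>k. cmod (a k))\<^sup>2"
      using power_mono[OF norm_tser_le[OF a, of x] norm_ge_zero, of 2] by simp
  qed
  show "(\<lambda>x. (cmod (f x))\<^sup>2) \<in> borel_measurable torus"
    using m by measurable
qed

lemma series_rep_sobolev:
  assumes "series_rep f a" "in_h s a"
  shows "f \<in> sobolev s" and "sobolev_norm s f = h_norm s a"
  using assms(2) series_rep_square_integrable[OF assms(1)] series_rep_coeff[OF assms(1)]
    assms(1)[unfolded series_rep_def]
  by (simp_all add: sobolev_def sobolev_norm_def in_h_def h_norm_def wt_def)

lemma series_rep_linear:
  assumes "series_rep f a" "series_rep g b"
  shows "series_rep (\<lambda>x. f x + c * g x) (\<lambda>k. a k + c * b k)"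
  unfolding series_rep_def
proof (intro conjI)
  have a: "ell1 a" "f \<in> borel_measurable torus" "AE x in torus. f x = tser a x"
    and b: "ell1 b" "g \<in> borel_measurable torus" "AE x in torus. g x = tser b x"
    using assms by (auto simp: series_rep_def)
  show "ell1 (\<lambda>k. a k + c * b k)"
    by (rule ell1_linear[OF a(1) b(1)])
  show "(\<lambda>x. f x + c * g x) \<in> borel_measurable torus"
    by (intro borel_measurable_add borel_measurable_times borel_measurable_const a b)
  from a(3) b(3) show "AE x in torus. f x + c * g x = tser (\<lambda>k. a k + c * b k) x"
    by eventually_elim (simp only: tser_linear[OF a(1) b(1)])
qed

lemma series_rep_diff:
  assumes "series_rep f a" "series_rep g b"
  shows "series_rep (\<lambda>x. f x - c * g x) (\<lambda>k. a k - c * b k)"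
  using series_rep_linear[OF assms, of "- c"] by simp

lemma series_rep_square:
  assumes "series_rep f a"
  shows "series_rep (\<lambda>x. (f x)\<^sup>2) (conv a a)"
  unfolding series_rep_def
proof (intro conjI)
  have a: "ell1 a" "f \<in> borel_measurable torus" "AE x in torus. f x = tser a x"
    using assms by (auto simp: series_rep_def)
  show "ell1 (conv a a)"
    by (rule conv_ell1(1)[OF a(1) a(1)])
  show "(\<lambda>x. (f x)\<^sup>2) \<in> borel_measurable torus"
    by (intro borel_measurable_power a)
  from a(3) show "AE x in torus. (f x)\<^sup>2 = tser (conv a a) x"
    by eventually_elim (simp only: tser_mult[OF a(1) a(1), symmetric] power2_eq_square)
qed

lemma series_rep_tser: "ell1 a \<Longrightarrow> series_rep (tser a) a"
  by (simp add: series_rep_def tser_measurable)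

lemma fourier_multiplier_tser: "fourier_multiplier m f = tser (\<lambda>k. m k * fourier_coeff f k)"
  by (simp add: fourier_multiplier_def tser_def fun_eq_iff)

lemma series_rep_multiplier:
  assumes "series_rep f a" "ell1 (\<lambda>k. m k * a k)"
  shows "series_rep (fourier_multiplier m f) (\<lambda>k. m k * a k)"
  unfolding fourier_multiplier_tser series_rep_coeff[OF assms(1)] by (rule series_rep_tser[OF assms(2)])

text \<open>A series that does not converge absolutely is given the value \<open>0\<close> at every point.\<close>

lemma fourier_multiplier_rep: "\<exists>c. series_rep (fourier_multiplier m f) c"
proof (cases "ell1 (\<lambda>k. m k * fourier_coeff f k)")
  case True
  from series_rep_tser[OF True] show ?thesis
    by (auto simp: fourier_multiplier_tser)
next
  case False
  then have "tser (\<lambda>k. m k * fourier_coeff f k) = (\<lambda>x. 0)"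
    by (intro ext, unfold tser_def, intro infsum_not_exists)
      (simp add: summable_on_iff_abs_summable_on_complex norm_mult)
  moreover have "tser (\<lambda>k. 0) = (\<lambda>x. 0)"
    by (simp add: tser_def fun_eq_iff)
  moreover have "series_rep (tser (\<lambda>k. 0)) (\<lambda>k. 0)"
    by (rule series_rep_tser) simp
  ultimately show ?thesis
    by (auto simp: fourier_multiplier_tser)
qed

section \<open>Time integrals of Fourier series\<close>

lemma ell1_integral:
  fixes c :: "real \<Rightarrow> int \<Rightarrow> complex"
  assumes "0 \<le> t" and cont: "\<And>k. continuous_on {0..t} (\<lambda>s. c s k)"
    and c: "\<And>s. s \<in> {0..t} \<Longrightarrow> ell1 (c s)" "\<And>s. s \<in> {0..t} \<Longrightarrow> (\<Sum>\<^sub>\<infinity>k. cmod (c s k)) \<le> M"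
  shows "ell1 (\<lambda>k. integral {0..t} (\<lambda>s. c s k))"
proof (rule nonneg_bdd_above_summable_on)
  show "bdd_above (sum (\<lambda>k. cmod (integral {0..t} (\<lambda>s. c s k))) ` {F. F \<subseteq> UNIV \<and> finite F})"
  proof (rule bdd_aboveI2)
    fix F :: "int set" assume "F \<in> {F. F \<subseteq> UNIV \<and> finite F}"
    then have F: "finite F" by simp
    have ni: "(\<lambda>s. cmod (c s k)) integrable_on {0..t}" for k
      by (intro integrable_continuous_interval continuous_on_norm cont)
    have "(\<Sum>k\<in>F. cmod (integral {0..t} (\<lambda>s. c s k))) \<le> (\<Sum>k\<in>F. integral {0..t} (\<lambda>s. cmod (c s k)))"
      by (intro sum_mono integral_norm_bound_integral ni integrable_continuous_interval cont) simp
    also have "\<dots> = integral {0..t} (\<lambda>s. \<Sum>k\<in>F. cmod (c s k))"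
      by (simp add: integral_sum F ni)
    also have "\<dots> \<le> integral {0..t} (\<lambda>s. M)"
    proof (rule integral_le)
      show "(\<lambda>s. \<Sum>k\<in>F. cmod (c s k)) integrable_on {0..t}"
        by (intro integrable_sum F ni)
      show "(\<Sum>k\<in>F. cmod (c s k)) \<le> M" if "s \<in> {0..t}" for s
        using finite_sum_le_infsum[OF c(1)[OF that] F] c(2)[OF that] by force
    qed (intro integrable_continuous_interval continuous_on_const)
    finally show "(\<Sum>k\<in>F. cmod (integral {0..t} (\<lambda>s. c s k))) \<le> integral {0..t} (\<lambda>s. M)" .
  qed
qed simp

text \<open>Dominated convergence in time for fixed \<open>y\<close>, with the constant majorant
  \<open>M\<close>. It turns the pointwise integral of \<open>mild_solution\<close> into integrals
  of single coefficients.\<close>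

lemma integral_tser:
  fixes c :: "real \<Rightarrow> int \<Rightarrow> complex"
  assumes "0 \<le> t" and cont: "\<And>k. continuous_on {0..t} (\<lambda>s. c s k)"
    and c: "\<And>s. s \<in> {0..t} \<Longrightarrow> ell1 (c s)" "\<And>s. s \<in> {0..t} \<Longrightarrow> (\<Sum>\<^sub>\<infinity>k. cmod (c s k)) \<le> M"
  shows "integral {0..t} (\<lambda>s. tser (c s) y) = tser (\<lambda>k. integral {0..t} (\<lambda>s. c s k)) y"
proof -
  define e where "e k = exp (\<i> * of_int k * of_real y)" for k :: int
  define f where "f n s = (\<Sum>k\<in>{- int n..int n}. c s k * e k)" for n s
  have ci: "(\<lambda>s. c s k) integrable_on {0..t}" for k
    by (intro integrable_continuous_interval cont)
  have "(\<lambda>n. integral {0..t} (f n)) \<longlonglongrightarrow> integral {0..t} (\<lambda>s. tser (c s) y)"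
  proof (rule dominated_convergence(2))
    show "f n integrable_on {0..t}" for n
      unfolding f_def by (intro integrable_continuous_interval continuous_intros cont)
    show "(\<lambda>_. M) integrable_on {0..t}"
      by (intro integrable_continuous_interval continuous_on_const)
    show "norm (f n s) \<le> M" if "s \<in> {0..t}" for n s
      unfolding f_def e_def
      by (rule order_trans[OF ell1_partial_sum_le[OF c(1)[OF that] finite_atLeastAtMost_int] c(2)[OF that]])
    show "(\<lambda>n. f n s) \<longlonglongrightarrow> tser (c s) y" if "s \<in> {0..t}" for s
      unfolding f_def e_def by (rule tser_tendsto[OF c(1)[OF that]])
  qed
  moreover have "integral {0..t} (f n) = (\<Sum>k\<in>{- int n..int n}. integral {0..t} (\<lambda>s. c s k) * e k)" for n
    unfolding f_def by (subst integral_sum) (auto intro!: integrable_on_mult_left ci)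
  then have "(\<lambda>n. integral {0..t} (f n)) \<longlonglongrightarrow> tser (\<lambda>k. integral {0..t} (\<lambda>s. c s k)) y"
    using tser_tendsto[OF ell1_integral[OF assms], of y] by (simp add: e_def)
  ultimately show ?thesis
    by (rule LIMSEQ_unique)
qed

section \<open>Symbols and mild solutions\<close>

text \<open>For \<open>z = \<epsilon> * wt k\<close> one has
  \<open>z powr \<mu> \<le> 1 + z\<close>, and \<open>1 + z\<close> is at most twice the denominator
  because \<open>\<epsilon> \<le> 1\<close>. Decay in \<open>wt\<close> is bought with negative
  powers of \<open>\<epsilon>\<close>.\<close>

lemma inverse_dispersion_le:
  assumes "0 < \<epsilon>" "\<epsilon> \<le> 1" "0 \<le> \<mu>" "\<mu> \<le> 1"
  shows "1 / (1 + \<epsilon> * (of_int k)\<^sup>2) \<le> 2 * \<epsilon> powr - \<mu> * wt k powr - \<mu>"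
proof -
  define z where "z = \<epsilon> * wt k"
  have z: "0 < z"
    using assms by (simp add: z_def)
  have "z powr \<mu> \<le> 1 + z"
  proof (cases "z \<le> 1")
    case True
    then have "z powr \<mu> \<le> 1"
      using z assms by (intro powr_le1) auto
    then show ?thesis using z by simp
  next
    case False
    then have "z powr \<mu> \<le> z powr 1"
      using assms by (intro powr_mono) auto
    then show ?thesis using z by simp
  qed
  also have "\<dots> \<le> 2 * (1 + \<epsilon> * (of_int k)\<^sup>2)"
  proof -
    have "0 \<le> \<epsilon> * (of_int k)\<^sup>2"
      using assms by simp
    then show ?thesis
      using assms unfolding z_def wt_def distrib_left by linarith
  qed
  finally have *: "z powr \<mu> \<le> 2 * (1 + \<epsilon> * (of_int k)\<^sup>2)" .
  have pos: "0 < 1 + \<epsilon> * (of_int k :: real)\<^sup>2"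
    using assms by (simp add: add_pos_nonneg)
  have "1 / (1 + \<epsilon> * (of_int k)\<^sup>2) \<le> 2 / z powr \<mu>"
    using * pos z by (simp add: field_simps)
  also have "\<dots> = 2 * \<epsilon> powr - \<mu> * wt k powr - \<mu>"
    using assms by (simp add: z_def powr_mult powr_minus divide_simps)
  finally show ?thesis .
qed

lemma cmod_dispersion_denominator:
  assumes "0 < \<epsilon>"
  shows "cmod (1 + of_real \<epsilon> * (of_int k)\<^sup>2) = 1 + \<epsilon> * (of_int k)\<^sup>2"
proof -
  have "1 + of_real \<epsilon> * (of_int k)\<^sup>2 = (of_real (1 + \<epsilon> * (of_int k)\<^sup>2) :: complex)"
    by simp
  then show ?thesis
    using assms by (simp only: norm_of_real) (simp add: add_nonneg_nonneg)
qed

text \<open>The interpolation bound at \<open>\<mu> = 1 - \<theta>\<close>, with half a power of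
  \<open>wt\<close> for the derivative. Raising \<open>\<theta>\<close> trades smoothing for powers
  of \<open>\<epsilon>\<close>.\<close>

lemma eps_symbol_L_le:
  assumes "0 < \<epsilon>" "\<epsilon> \<le> 1" "0 \<le> \<theta>" "\<theta> \<le> 1"
  shows "cmod (of_real \<epsilon> * symbol_L \<epsilon> k) \<le> 2 * \<epsilon> powr \<theta> * wt k powr (\<theta> - 1 / 2)"
proof -
  have "cmod (of_real \<epsilon> * symbol_L \<epsilon> k) = \<epsilon> * \<bar>of_int k\<bar> * (1 / (1 + \<epsilon> * (of_int k)\<^sup>2))"
    using assms by (simp add: symbol_L_def norm_mult norm_divide cmod_dispersion_denominator)
  also have "\<dots> \<le> \<epsilon> * wt k powr (1 / 2) * (2 * \<epsilon> powr - (1 - \<theta>) * wt k powr - (1 - \<theta>))"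
    using assms
    by (intro mult_mono mult_left_mono inverse_dispersion_le abs_le_sqrt_wt) auto
  also have "\<dots> = 2 * (\<epsilon> powr 1 * \<epsilon> powr - (1 - \<theta>)) * (wt k powr (1 / 2) * wt k powr - (1 - \<theta>))"
    using assms by simp
  also have "\<dots> = 2 * \<epsilon> powr \<theta> * wt k powr (\<theta> - 1 / 2)"
    unfolding powr_add[symmetric] by simp
  finally show ?thesis .
qed

lemma poly_imaginary_le:
  "cmod (poly P (\<i> * of_int k)) \<le> (\<Sum>i\<le>degree P. cmod (coeff P i)) * wt k powr (degree P / 2)"
proof -
  have "cmod (poly P (\<i> * of_int k)) \<le> (\<Sum>i\<le>degree P. cmod (coeff P i) * wt k powr (degree P / 2))"
    unfolding poly_altdef
  proof (rule sum_norm_le)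
    fix i assume i: "i \<in> {..degree P}"
    have "\<bar>real_of_int k\<bar> ^ i \<le> (wt k powr (1 / 2)) ^ i"
      by (intro power_mono abs_le_sqrt_wt) simp
    also have "\<dots> = wt k powr (i / 2)"
      by (simp add: powr_power)
    also have "\<dots> \<le> wt k powr (degree P / 2)"
      using i by (intro powr_mono wt_ge_1) auto
    finally have "\<bar>real_of_int k\<bar> ^ i \<le> wt k powr (degree P / 2)" .
    then show "cmod (coeff P i * (\<i> * of_int k) ^ i) \<le> cmod (coeff P i) * wt k powr (degree P / 2)"
      by (simp add: norm_mult norm_power mult_left_mono)
  qed
  then show ?thesis
    by (simp add: sum_distrib_right)
qed

lemma symbol_LP_le:
  assumes "0 < \<epsilon>" "\<epsilon> \<le> 1" "0 \<le> \<mu>" "\<mu> \<le> 1"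
  shows "cmod (symbol_LP P \<epsilon> k)
    \<le> 2 * (\<Sum>i\<le>degree P. cmod (coeff P i)) * \<epsilon> powr - \<mu> * wt k powr (degree P / 2 - \<mu>)"
proof -
  define S where "S = (\<Sum>i\<le>degree P. cmod (coeff P i))"
  have "cmod (symbol_LP P \<epsilon> k) = cmod (poly P (\<i> * of_int k)) * (1 / (1 + \<epsilon> * (of_int k)\<^sup>2))"
    using assms by (simp add: symbol_LP_def norm_divide cmod_dispersion_denominator)
  also have "\<dots> \<le> (S * wt k powr (degree P / 2)) * (2 * \<epsilon> powr - \<mu> * wt k powr - \<mu>)"
    unfolding S_def using assms
    by (intro mult_mono poly_imaginary_le inverse_dispersion_le mult_nonneg_nonneg sum_nonneg) auto
  also have "\<dots> = 2 * S * \<epsilon> powr - \<mu> * (wt k powr (degree P / 2) * wt k powr - \<mu>)"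
    by simp
  also have "\<dots> = 2 * S * \<epsilon> powr - \<mu> * wt k powr (degree P / 2 - \<mu>)"
    unfolding powr_add[symmetric] by simp
  finally show ?thesis
    unfolding S_def .
qed

lemma Re_symbol_LP:
  assumes "\<forall>x::real. Re (poly P (\<i> * of_real x)) = 0"
  shows "Re (symbol_LP P \<epsilon> k) = 0"
proof -
  have "symbol_LP P \<epsilon> k = poly P (\<i> * of_real (of_int k)) / of_real (1 + \<epsilon> * (of_int k)\<^sup>2)"
    by (simp add: symbol_LP_def)
  then show ?thesis
    using assms by (simp only: Re_divide_of_real)
qed

text \<open>Chord against arc on the unit circle. The bound is linear in \<open>t\<close> and has no
  exponential growth factor.\<close>

lemma norm_exp_imaginary_minus_1:
  assumes "Re z = 0"
  shows "cmod (exp (of_real t * z) - 1) \<le> \<bar>t\<bar> * cmod z"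
proof -
  have z: "of_real t * z = \<i> * of_real (t * Im z)"
    using assms by (simp add: complex_eq_iff)
  have "cmod (exp (of_real t * z) - 1) = 2 * \<bar>sin (t * Im z / 2)\<bar>"
    unfolding z by (rule dist_exp_i_1)
  also have "\<dots> \<le> \<bar>t\<bar> * \<bar>Im z\<bar>"
    using abs_sin_x_le_abs_x[of "t * Im z / 2"] by (simp add: abs_mult)
  also have "\<dots> \<le> \<bar>t\<bar> * cmod z"
    by (intro mult_left_mono abs_Im_le_cmod) simp
  finally show ?thesis .
qed

section \<open>Fourier coefficients of a fixed mild solution\<close>

locale bbm_solution =
  fixes P :: "complex poly" and \<epsilon> T s :: real and u :: "real \<Rightarrow> real \<Rightarrow> complex"
  assumes skew: "\<forall>x::real. Re (poly P (\<i> * of_real x)) = 0"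
    and eps: "0 < \<epsilon>" "\<epsilon> \<le> 1" and T: "0 < T" and s: "1 / 2 < s"
    and cont: "u \<in> cont_sobolev T s" and mild: "mild_solution P \<epsilon> T u"
begin

definition flow :: "real \<Rightarrow> int \<Rightarrow> complex" where
  "flow t k = exp (of_real t * symbol_LP P \<epsilon> k)"

definition a :: "real \<Rightarrow> int \<Rightarrow> complex" where
  "a t = fourier_coeff (u t)"

text \<open>These are the coefficients of the squared solution, by \<open>series_rep_square\<close>
  once \<open>u_rep\<close> is available.\<close>

definition q :: "real \<Rightarrow> int \<Rightarrow> complex" where
  "q t = conv (a t) (a t)"

lemma norm_flow [simp]: "cmod (flow t k) = 1"
  by (simp add: flow_def norm_exp_eq_Re Re_symbol_LP[OF skew])

lemma flow_add: "flow (t + t') k = flow t k * flow t' k"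
  by (simp add: flow_def distrib_right exp_add)

lemma exp_LP_eq: "exp_LP P \<epsilon> t = fourier_multiplier (flow t)"
  by (simp add: exp_LP_def flow_def[abs_def])

lemma h_flow:
  assumes "in_h p b"
  shows "in_h p (\<lambda>k. flow t k * b k)" and "h_norm p (\<lambda>k. flow t k * b k) \<le> h_norm p b"
  using h_dominated[OF assms, of 1 p "\<lambda>k. flow t k * b k"] by (auto simp: norm_mult)

lemma ell1_flow: "ell1 b \<Longrightarrow> ell1 (\<lambda>k. flow t k * b k)"
  by (simp add: norm_mult)

lemma eps_symbol_L_le_2: "cmod (of_real \<epsilon> * symbol_L \<epsilon> k) \<le> 2"
proof -
  have "cmod (of_real \<epsilon> * symbol_L \<epsilon> k) \<le> 2 * \<epsilon> powr (1 / 2) * wt k powr (1 / 2 - 1 / 2)"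
    by (intro eps_symbol_L_le eps) auto
  moreover have "\<epsilon> powr (1 / 2) \<le> 1"
    using eps by (intro powr_le1) auto
  ultimately show ?thesis by simp
qed

text \<open>The majorant carries the factor \<open>2 / \<epsilon>\<close>, which degenerates for
  small \<open>\<epsilon>\<close>; this is harmless, as only summability is recorded.\<close>

lemma ell1_symbol_L:
  assumes "ell1 b"
  shows "ell1 (\<lambda>k. symbol_L \<epsilon> k * b k)"
proof (rule summable_on_comparison_test)
  show "(\<lambda>k. 2 / \<epsilon> * cmod (b k)) summable_on UNIV"
    by (intro summable_on_cmult_right assms)
  show "cmod (symbol_L \<epsilon> k * b k) \<le> 2 / \<epsilon> * cmod (b k)" for k
    using mult_right_mono[OF eps_symbol_L_le_2[of k] norm_ge_zero[of "b k"]] eps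
    by (simp add: norm_mult field_simps)
qed simp

text \<open>The right side of the mild equation combines two multiplier outputs, and such an output
  is an absolutely convergent series whatever its argument. Hence \<open>u t\<close> is one as well,
  and its coefficients can only be \<open>a t\<close>.\<close>

lemma u_rep:
  assumes "t \<in> {0..T}"
  shows "series_rep (u t) (a t)"
proof -
  obtain c1 where c1: "series_rep (exp_LP P \<epsilon> (- t) (u 0)) c1"
    unfolding exp_LP_def using fourier_multiplier_rep by blast
  obtain c2 where c2: "series_rep (op_L \<epsilon> (\<lambda>y. integral {0..t}
      (\<lambda>s. exp_LP P \<epsilon> (- (t - s)) (\<lambda>z. (u s z)\<^sup>2) y))) c2"
    unfolding op_L_def using fourier_multiplier_rep by blast
  have r: "series_rep (\<lambda>x. exp_LP P \<epsilon> (- t) (u 0) x - of_real \<epsilon> * op_L \<epsilon> (\<lambda>y. integral {0..t}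
      (\<lambda>s. exp_LP P \<epsilon> (- (t - s)) (\<lambda>z. (u s z)\<^sup>2) y)) x) (\<lambda>k. c1 k - of_real \<epsilon> * c2 k)"
    by (rule series_rep_diff[OF c1 c2])
  have ae: "AE x in torus. u t x = exp_LP P \<epsilon> (- t) (u 0) x - of_real \<epsilon> * op_L \<epsilon> (\<lambda>y. integral {0..t}
      (\<lambda>s. exp_LP P \<epsilon> (- (t - s)) (\<lambda>z. (u s z)\<^sup>2) y)) x"
    using mild assms by (auto simp: mild_solution_def)
  have "u t \<in> borel_measurable torus"
    using cont assms by (auto simp: cont_sobolev_def sobolev_def)
  moreover have "AE x in torus. u t x = tser (\<lambda>k. c1 k - of_real \<epsilon> * c2 k) x"
  proof -
    from r have "AE x in torus. exp_LP P \<epsilon> (- t) (u 0) x - of_real \<epsilon> * op_L \<epsilon> (\<lambda>y. integral {0..t}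
      (\<lambda>s. exp_LP P \<epsilon> (- (t - s)) (\<lambda>z. (u s z)\<^sup>2) y)) x = tser (\<lambda>k. c1 k - of_real \<epsilon> * c2 k) x"
      by (simp only: series_rep_def)
    with ae show ?thesis
      by eventually_elim (rule trans)
  qed
  ultimately have "series_rep (u t) (\<lambda>k. c1 k - of_real \<epsilon> * c2 k)"
    using r by (simp add: series_rep_def)
  with series_rep_coeff[OF this] show ?thesis
    by (simp add: a_def)
qed

lemma in_h_a:
  assumes "t \<in> {0..T}"
  shows "in_h s (a t)"
  using cont assms by (auto simp: cont_sobolev_def sobolev_def in_h_def wt_def a_def)

lemma sobolev_norm_u: "sobolev_norm s (u t) = h_norm s (a t)"
  by (simp add: sobolev_norm_def h_norm_def wt_def a_def)

lemma in_h_0: "in_h s b \<Longrightarrow> in_h 0 b"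
  using s by (auto intro: h_embed(1)[where p = 0])

lemma h_norm_0_le: "in_h s b \<Longrightarrow> h_norm 0 b \<le> h_norm s b"
  using s by (auto intro: h_embed(2)[where p = 0])

lemma a_continuous:
  assumes "t \<in> {0..T}"
  shows "((\<lambda>t'. h_norm s (\<lambda>k. a t' k - a t k)) \<longlongrightarrow> 0) (at t within {0..T})"
proof -
  have *: "sobolev_norm s (\<lambda>x. u t' x - u t x) = h_norm s (\<lambda>k. a t' k - a t k)" if "t' \<in> {0..T}" for t'
    using series_rep_diff[OF u_rep[OF that] u_rep[OF assms], of 1]
      h_diff(1)[OF in_h_a[OF that] in_h_a[OF assms]]
    by (intro series_rep_sobolev(2)) simp_all
  have "((\<lambda>t'. sobolev_norm s (\<lambda>x. u t' x - u t x)) \<longlongrightarrow> 0) (at t within {0..T})"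
    using cont assms by (auto simp: cont_sobolev_def)
  then show ?thesis
    by (rule Lim_transform_eventually) (auto simp: eventually_at_filter *)
qed

text \<open>The reverse triangle inequality makes the norm continuous in time, and compactness
  bounds it. This gives the supremum \<open>M\<close> its meaning.\<close>

lemma norm_a_bdd: "bdd_above ((\<lambda>t. h_norm s (a t)) ` {0..T})"
proof -
  have "continuous_on {0..T} (\<lambda>t. h_norm s (a t))"
    unfolding continuous_on_def
  proof
    fix t assume t: "t \<in> {0..T}"
    have tri: "h_norm s (a x) \<le> h_norm s (a y) + h_norm s (\<lambda>k. a x k - a y k)"
      if "x \<in> {0..T}" "y \<in> {0..T}" for x y
      using h_add(2)[OF in_h_a[OF that(2)] h_diff(1)[OF in_h_a[OF that(1)] in_h_a[OF that(2)]]] by simp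
    have sym: "h_norm s (\<lambda>k. a x k - a y k) = h_norm s (\<lambda>k. a y k - a x k)" for x y
      using h_uminus(2)[of s "\<lambda>k. a x k - a y k"] by simp
    have "norm (h_norm s (a t') - h_norm s (a t)) \<le> h_norm s (\<lambda>k. a t' k - a t k)"
      if "t' \<in> {0..T}" for t'
      using tri[OF that t] tri[OF t that] sym[of t t'] by (simp add: abs_le_iff)
    then have "((\<lambda>t'. h_norm s (a t') - h_norm s (a t)) \<longlongrightarrow> 0) (at t within {0..T})"
      by (intro Lim_null_comparison[OF _ a_continuous[OF t]]) (auto simp: eventually_at_filter)
    then show "((\<lambda>t. h_norm s (a t)) \<longlongrightarrow> h_norm s (a t)) (at t within {0..T})"
      by (rule LIM_zero_cancel)
  qed
  then show ?thesis
    by (intro bounded_imp_bdd_above compact_imp_bounded compact_continuous_image) auto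
qed

definition M :: real where
  "M = (SUP t\<in>{0..T}. h_norm s (a t))"

lemma norm_a_le: "t \<in> {0..T} \<Longrightarrow> h_norm s (a t) \<le> M"
  unfolding M_def by (rule cSUP_upper[OF _ norm_a_bdd])

lemma M_nonneg: "0 \<le> M"
  using order_trans[OF h_norm_nonneg norm_a_le[of 0]] T by simp

text \<open>Continuity of single coefficients suffices to integrate them in Duhamel's formula. It
  follows from the difference of squares and the embedding of H^s into H^0.\<close>

lemma q_continuous: "continuous_on {0..T} (\<lambda>t. q t k)"
  unfolding continuous_on_def
proof
  fix t assume t: "t \<in> {0..T}"
  have le: "norm (q t' k - q t k) \<le> (2 * M) * h_norm s (\<lambda>k. a t' k - a t k)" if t': "t' \<in> {0..T}" for t'
  proof -
    have "norm (q t' k - q t k) = cmod (conv (\<lambda>k. a t' k + a t k) (\<lambda>k. a t' k - a t k) k)"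
      unfolding q_def by (subst conv_diff_squares) (auto intro!: in_h_0 in_h_a t t')
    also have "\<dots> \<le> h_norm 0 (\<lambda>k. a t' k + a t k) * h_norm 0 (\<lambda>k. a t' k - a t k)"
      by (intro conv_summable h_add h_diff in_h_0 in_h_a t t')
    also have "\<dots> \<le> h_norm s (\<lambda>k. a t' k + a t k) * h_norm s (\<lambda>k. a t' k - a t k)"
      by (intro mult_mono h_norm_0_le h_add h_diff in_h_a t t' h_norm_nonneg)
    also have "\<dots> \<le> (2 * M) * h_norm s (\<lambda>k. a t' k - a t k)"
      using h_add(2)[OF in_h_a[OF t'] in_h_a[OF t]] norm_a_le[OF t] norm_a_le[OF t']
      by (intro mult_right_mono) auto
    finally show ?thesis .
  qed
  have lim: "((\<lambda>t'. (2 * M) * h_norm s (\<lambda>k. a t' k - a t k)) \<longlongrightarrow> 0) (at t within {0..T})"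
    by (rule tendsto_mult_right_zero[OF a_continuous[OF t]])
  have "((\<lambda>t'. q t' k - q t k) \<longlongrightarrow> 0) (at t within {0..T})"
    by (rule Lim_null_comparison[OF _ lim]) (auto simp: eventually_at_filter le)
  then show "((\<lambda>t. q t k) \<longlongrightarrow> q t k) (at t within {0..T})"
    by (rule LIM_zero_cancel)
qed

lemma in_h_q:
  assumes "t \<in> {0..T}"
  shows "in_h s (q t)"
    and "h_norm s (q t) \<le> conv_bound s s * M * M"
proof -
  show "in_h s (q t)"
    unfolding q_def using s by (intro h_conv(1)[OF s] in_h_a assms) auto
  have "h_norm s (q t) \<le> conv_bound s s * h_norm s (a t) * h_norm s (a t)"
    unfolding q_def using s by (intro h_conv(2)[OF s] in_h_a assms) auto
  also have "\<dots> \<le> conv_bound s s * M * M"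
    by (intro mult_mono mult_left_mono norm_a_le assms mult_nonneg_nonneg) (auto simp: M_nonneg)
  finally show "h_norm s (q t) \<le> conv_bound s s * M * M" .
qed

lemma flow_continuous: "continuous_on A (\<lambda>t. flow (t - c) k)"
  unfolding flow_def by (intro continuous_intros)

text \<open>The mild equation read on coefficients, after exchanging series and time integral. Under
  the integral, \<open>s\<close> is time and hides the Sobolev order of the locale.\<close>

lemma a_mild:
  assumes t: "t \<in> {0..T}"
  shows "a t k = flow (- t) k * a 0 k
    - of_real \<epsilon> * symbol_L \<epsilon> k * integral {0..t} (\<lambda>s. flow (s - t) k * q s k)"
proof -
  define g where "g k = integral {0..t} (\<lambda>s. flow (s - t) k * q s k)" for k
  define G where "G y = integral {0..t} (\<lambda>s. exp_LP P \<epsilon> (- (t - s)) (\<lambda>z. (u s z)\<^sup>2) y)" for y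
  have sub: "x \<in> {0..T}" if "x \<in> {0..t}" for x
    using that t by auto
  have cq: "continuous_on {0..t} (\<lambda>x. flow (x - t) k * q x k)" for k
    using t by (intro continuous_on_mult flow_continuous continuous_on_subset[OF q_continuous]) auto
  \<comment> \<open>A bound uniform in time, from the Sobolev embedding and the product estimate for
    \<open>q\<close>, licenses the exchange of series and integral.\<close>
  obtain B where B: "(\<Sum>\<^sub>\<infinity>k. cmod (flow (x - t) k * q x k)) \<le> B" if "x \<in> {0..t}" for x
  proof
    fix x assume x: "x \<in> {0..t}"
    show "(\<Sum>\<^sub>\<infinity>k. cmod (flow (x - t) k * q x k)) \<le> sqrt (\<Sum>\<^sub>\<infinity>k. wt k powr - s)
        * (conv_bound s s * M * M)"
      using in_h_imp_ell1(2)[OF in_h_q(1)[OF sub[OF x]] s]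
        mult_left_mono[OF in_h_q(2)[OF sub[OF x]], of "sqrt (\<Sum>\<^sub>\<infinity>k. wt k powr - s)"]
      by (simp add: norm_mult infsum_nonneg)
  qed
  have l1: "ell1 (\<lambda>k. flow (x - t) k * q x k)" if "x \<in> {0..t}" for x
    by (intro ell1_flow in_h_imp_ell1(1)[OF in_h_q(1)[OF sub[OF that]] s])
  have E: "exp_LP P \<epsilon> (- (t - x)) (\<lambda>z. (u x z)\<^sup>2) = tser (\<lambda>k. flow (x - t) k * q x k)"
    if "x \<in> {0..t}" for x
    using series_rep_coeff[OF series_rep_square[OF u_rep[OF sub[OF that]]]]
    by (simp add: exp_LP_eq fourier_multiplier_tser q_def)
  have t0: "0 \<le> t"
    using t by simp
  have "G y = integral {0..t} (\<lambda>x. tser (\<lambda>k. flow (x - t) k * q x k) y)" for y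
    unfolding G_def by (rule integral_cong) (simp only: E)
  then have G: "G = tser g"
    unfolding g_def fun_eq_iff using integral_tser[OF t0 cq l1 B] by simp
  have g: "ell1 g"
    unfolding g_def by (rule ell1_integral[OF t0 cq l1 B])
  have r1: "series_rep (op_L \<epsilon> G) (\<lambda>k. symbol_L \<epsilon> k * g k)"
    unfolding op_L_def G by (rule series_rep_multiplier[OF series_rep_tser[OF g] ell1_symbol_L[OF g]])
  have u0: "series_rep (u 0) (a 0)"
    by (rule u_rep) (use T in simp)
  have r2: "series_rep (exp_LP P \<epsilon> (- t) (u 0)) (\<lambda>k. flow (- t) k * a 0 k)"
    unfolding exp_LP_eq using u0
    by (intro series_rep_multiplier ell1_flow) (auto simp: series_rep_def)
  have r: "series_rep (\<lambda>x. exp_LP P \<epsilon> (- t) (u 0) x - of_real \<epsilon> * op_L \<epsilon> G x)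
      (\<lambda>k. flow (- t) k * a 0 k - of_real \<epsilon> * (symbol_L \<epsilon> k * g k))"
    by (rule series_rep_diff[OF r2 r1])
  have ae: "AE x in torus. u t x = exp_LP P \<epsilon> (- t) (u 0) x - of_real \<epsilon> * op_L \<epsilon> G x"
    using mild t unfolding mild_solution_def G_def by blast
  have "series_rep (u t) (\<lambda>k. flow (- t) k * a 0 k - of_real \<epsilon> * (symbol_L \<epsilon> k * g k))"
    unfolding series_rep_def
  proof (intro conjI)
    show "u t \<in> borel_measurable torus"
      using u_rep[OF t] by (simp add: series_rep_def)
    show "ell1 (\<lambda>k. flow (- t) k * a 0 k - of_real \<epsilon> * (symbol_L \<epsilon> k * g k))"
      using r by (simp add: series_rep_def)
    from r have "AE x in torus. exp_LP P \<epsilon> (- t) (u 0) x - of_real \<epsilon> * op_L \<epsilon> G x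
        = tser (\<lambda>k. flow (- t) k * a 0 k - of_real \<epsilon> * (symbol_L \<epsilon> k * g k)) x"
      by (simp only: series_rep_def)
    with ae show "AE x in torus. u t x = tser (\<lambda>k. flow (- t) k * a 0 k - of_real \<epsilon> * (symbol_L \<epsilon> k * g k)) x"
      by eventually_elim (rule trans)
  qed
  from series_rep_coeff[OF this] show ?thesis
    by (simp add: a_def[symmetric] g_def fun_eq_iff mult.assoc)
qed

text \<open>Restart at time \<open>t\<close>: the integral is split there, and by the group property
  of the flow the earlier part recombines with the initial value into
  \<open>flow (- h) k * a t k\<close>.\<close>

lemma a_duhamel:
  assumes t: "0 \<le> t" "0 \<le> h" "t + h \<le> T"
  shows "a (t + h) k = flow (- h) k * a t k
    - of_real \<epsilon> * symbol_L \<epsilon> k * integral {0..h} (\<lambda>x. flow (x - h) k * q (t + x) k)"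
proof -
  have c: "continuous_on {0..t + h} (\<lambda>x. flow (x - (t + h)) k * q x k)"
    using t by (intro continuous_on_mult flow_continuous continuous_on_subset[OF q_continuous]) auto
  have "integral {0..t + h} (\<lambda>x. flow (x - (t + h)) k * q x k)
      = integral {0..t} (\<lambda>x. flow (x - (t + h)) k * q x k)
        + integral {t..t + h} (\<lambda>x. flow (x - (t + h)) k * q x k)"
    using t by (intro Henstock_Kurzweil_Integration.integral_combine[symmetric]
        integrable_continuous_interval c) auto
  also have "integral {0..t} (\<lambda>x. flow (x - (t + h)) k * q x k)
      = flow (- h) k * integral {0..t} (\<lambda>x. flow (x - t) k * q x k)"
  proof -
    have eq: "flow (x - (t + h)) k * q x k = flow (- h) k * (flow (x - t) k * q x k)" for x
      using flow_add[of "- h" "x - t" k] by (simp add: algebra_simps)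
    show ?thesis
      by (simp only: eq integral_mult_right)
  qed
  also have "integral {t..t + h} (\<lambda>x. flow (x - (t + h)) k * q x k)
      = integral {0..h} (\<lambda>x. flow (x - h) k * q (t + x) k)"
    using integral_shift_Icc_real[of 0 h "\<lambda>x. flow (x - (t + h)) k * q x k" t]
    by (simp add: o_def add.commute)
  finally have I: "integral {0..t + h} (\<lambda>x. flow (x - (t + h)) k * q x k)
      = flow (- h) k * integral {0..t} (\<lambda>x. flow (x - t) k * q x k)
        + integral {0..h} (\<lambda>x. flow (x - h) k * q (t + x) k)" .
  have "flow (- (t + h)) k = flow (- h) k * flow (- t) k"
    unfolding flow_add[symmetric] by (rule arg_cong2[where f = flow]) simp_all
  moreover have "a t k = flow (- t) k * a 0 k
      - of_real \<epsilon> * symbol_L \<epsilon> k * integral {0..t} (\<lambda>x. flow (x - t) k * q x k)"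
    using t by (intro a_mild) auto
  moreover have "a (t + h) k = flow (- (t + h)) k * a 0 k
      - of_real \<epsilon> * symbol_L \<epsilon> k * integral {0..t + h} (\<lambda>x. flow (x - (t + h)) k * q x k)"
    using t by (intro a_mild) auto
  ultimately show ?thesis
    unfolding I by (simp only: right_diff_distrib distrib_left mult_ac diff_diff_eq)
qed

section \<open>Error estimates for one step\<close>

text \<open>One splitting step on coefficients: explicit Euler for the nonlinearity, then the exact
  linear flow.\<close>

definition \<Phi> :: "real \<Rightarrow> (int \<Rightarrow> complex) \<Rightarrow> int \<Rightarrow> complex" where
  "\<Phi> \<tau> b k = flow (- \<tau>) k * (b k - of_real \<tau> * (of_real \<epsilon> * symbol_L \<epsilon> k * conv b b k))"

text \<open>The relation between the orders says \<open>r = p + 1 - 2 * \<theta>\<close>: the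
  operator gains \<open>1 - 2 * \<theta>\<close> derivatives (a loss if negative) and contributes
  \<open>\<epsilon> powr \<theta>\<close>.\<close>

lemma h_eps_symbol_L:
  assumes "in_h p b" "0 \<le> \<theta>" "\<theta> \<le> 1" "\<theta> - 1 / 2 = (p - r) / 2"
  shows "in_h r (\<lambda>k. of_real \<epsilon> * symbol_L \<epsilon> k * b k)"
    and "h_norm r (\<lambda>k. of_real \<epsilon> * symbol_L \<epsilon> k * b k) \<le> 2 * \<epsilon> powr \<theta> * h_norm p b"
proof -
  have *: "cmod (of_real \<epsilon> * symbol_L \<epsilon> k * b k) \<le> 2 * \<epsilon> powr \<theta> * wt k powr ((p - r) / 2) * cmod (b k)" for k
    unfolding norm_mult[of "of_real \<epsilon> * symbol_L \<epsilon> k"] assms(4)[symmetric]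
    by (intro mult_right_mono eps_symbol_L_le eps assms) simp
  show "in_h r (\<lambda>k. of_real \<epsilon> * symbol_L \<epsilon> k * b k)"
    and "h_norm r (\<lambda>k. of_real \<epsilon> * symbol_L \<epsilon> k * b k) \<le> 2 * \<epsilon> powr \<theta> * h_norm p b"
    using h_dominated'[OF assms(1) _ *] by auto
qed

lemma h_eps_symbol_L_2:
  assumes "in_h p b"
  shows "in_h p (\<lambda>k. of_real \<epsilon> * symbol_L \<epsilon> k * b k)"
    and "h_norm p (\<lambda>k. of_real \<epsilon> * symbol_L \<epsilon> k * b k) \<le> 2 * h_norm p b"
proof -
  have *: "cmod (of_real \<epsilon> * symbol_L \<epsilon> k * b k) \<le> 2 * wt k powr ((p - p) / 2) * cmod (b k)" for k
    using mult_right_mono[OF eps_symbol_L_le_2[of k], of "cmod (b k)"] by (simp add: norm_mult)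
  show "in_h p (\<lambda>k. of_real \<epsilon> * symbol_L \<epsilon> k * b k)"
    and "h_norm p (\<lambda>k. of_real \<epsilon> * symbol_L \<epsilon> k * b k) \<le> 2 * h_norm p b"
    using h_dominated'[OF assms(1) _ *] by auto
qed

lemma in_h_\<Phi>:
  assumes "in_h s b"
  shows "in_h s (\<Phi> \<tau> b)"
  unfolding \<Phi>_def[abs_def] using s assms
  by (intro h_flow(1) h_diff(1) h_cmult(1) h_eps_symbol_L_2(1) h_conv(1)[OF s]) auto

text \<open>Membership in H^s is carried along because the next square must again be an absolutely
  convergent series. It is qualitative: no bound uniform in \<open>n\<close> is asserted.\<close>

lemma lie_splitting_rep:
  shows "series_rep (lie_splitting P \<epsilon> \<tau> (u 0) n) ((\<Phi> \<tau> ^^ n) (a 0))" and "in_h s ((\<Phi> \<tau> ^^ n) (a 0))"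
proof (induction n)
  case 0
  show "series_rep (lie_splitting P \<epsilon> \<tau> (u 0) 0) ((\<Phi> \<tau> ^^ 0) (a 0))" "in_h s ((\<Phi> \<tau> ^^ 0) (a 0))"
    using u_rep[of 0] in_h_a[of 0] T by auto
next
  case (Suc n)
  define b where "b = (\<Phi> \<tau> ^^ n) (a 0)"
  define f where "f = lie_splitting P \<epsilon> \<tau> (u 0) n"
  have b: "series_rep f b" "in_h s b"
    using Suc by (simp_all add: f_def b_def)
  have b': "in_h s (conv b b)"
    using s b by (intro h_conv(1)[OF s]) auto
  have r1: "series_rep (op_L \<epsilon> (\<lambda>y. (f y)\<^sup>2)) (\<lambda>k. symbol_L \<epsilon> k * conv b b k)"
    unfolding op_L_def
    by (intro series_rep_multiplier series_rep_square b ell1_symbol_L in_h_imp_ell1(1)[OF b' s])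
  have r2: "series_rep (\<lambda>x. f x - of_real \<tau> * of_real \<epsilon> * op_L \<epsilon> (\<lambda>y. (f y)\<^sup>2) x)
      (\<lambda>k. b k - of_real \<tau> * of_real \<epsilon> * (symbol_L \<epsilon> k * conv b b k))"
    by (rule series_rep_diff[OF b(1) r1])
  have r3: "series_rep (exp_LP P \<epsilon> (- \<tau>) (\<lambda>x. f x - of_real \<tau> * of_real \<epsilon> * op_L \<epsilon> (\<lambda>y. (f y)\<^sup>2) x))
      (\<lambda>k. flow (- \<tau>) k * (b k - of_real \<tau> * of_real \<epsilon> * (symbol_L \<epsilon> k * conv b b k)))"
    unfolding exp_LP_eq using r2
    by (intro series_rep_multiplier ell1_flow) (auto simp: series_rep_def)
  have "\<Phi> \<tau> b = (\<lambda>k. flow (- \<tau>) k * (b k - of_real \<tau> * of_real \<epsilon> * (symbol_L \<epsilon> k * conv b b k)))"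
    by (simp add: \<Phi>_def fun_eq_iff mult.assoc)
  then show "series_rep (lie_splitting P \<epsilon> \<tau> (u 0) (Suc n)) ((\<Phi> \<tau> ^^ Suc n) (a 0))"
    using r3 by (simp add: b_def f_def)
  show "in_h s ((\<Phi> \<tau> ^^ Suc n) (a 0))"
    using in_h_\<Phi>[OF b(2)] by (simp add: b_def)
qed

text \<open>One factor \<open>h\<close> is gained by paying the order \<open>s - p\<close> of the
  generator; \<open>D\<close> will carry the negative power of \<open>\<epsilon>\<close>.\<close>

lemma h_flow_minus_1:
  assumes "in_h s b" "0 \<le> D" and D: "\<And>k. cmod (symbol_LP P \<epsilon> k) \<le> D * wt k powr ((s - p) / 2)"
  shows "in_h p (\<lambda>k. (flow h k - 1) * b k)"
    and "h_norm p (\<lambda>k. (flow h k - 1) * b k) \<le> \<bar>h\<bar> * D * h_norm s b"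
proof -
  have "cmod ((flow h k - 1) * b k) \<le> (\<bar>h\<bar> * D) * wt k powr ((s - p) / 2) * cmod (b k)" for k
  proof -
    have "cmod (flow h k - 1) \<le> \<bar>h\<bar> * cmod (symbol_LP P \<epsilon> k)"
      unfolding flow_def by (intro norm_exp_imaginary_minus_1 Re_symbol_LP skew)
    also have "\<dots> \<le> \<bar>h\<bar> * (D * wt k powr ((s - p) / 2))"
      by (intro mult_left_mono D) simp
    finally show ?thesis
      unfolding norm_mult by (intro mult_right_mono) (auto simp: mult.assoc)
  qed
  from h_dominated'[OF assms(1) _ this] assms(2)
  show "in_h p (\<lambda>k. (flow h k - 1) * b k)"
    and "h_norm p (\<lambda>k. (flow h k - 1) * b k) \<le> \<bar>h\<bar> * D * h_norm s b"
    by auto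
qed

text \<open>By Duhamel's formula the increment is a linear part, controlled by
  \<open>h_flow_minus_1\<close>, plus an integral over length \<open>h\<close> that is of size
  \<open>h\<close> already in H^s.\<close>

lemma a_lipschitz:
  assumes t: "0 \<le> t" "0 \<le> h" "t + h \<le> T" and p: "p \<le> s" and D0: "0 \<le> D"
    and D: "\<And>k. cmod (symbol_LP P \<epsilon> k) \<le> D * wt k powr ((s - p) / 2)"
  shows "in_h p (\<lambda>k. a (t + h) k - a t k)"
    and "h_norm p (\<lambda>k. a (t + h) k - a t k) \<le> h * (D * M + 2 * (conv_bound s s * M * M))"
proof -
  define I where "I k = integral {0..h} (\<lambda>x. flow (x - h) k * q (t + x) k)" for k
  have sub: "t + x \<in> {0..T}" if "x \<in> {0..h}" for x
    using that t by auto
  have t': "t \<in> {0..T}"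
    using t by auto
  have c: "continuous_on {0..h} (\<lambda>x. flow (x - h) k * q (t + x) k)" for k
    using t by (intro continuous_on_mult flow_continuous continuous_on_compose2[OF q_continuous]
        continuous_intros) auto
  have fq: "in_h s (\<lambda>k. flow (x - h) k * q (t + x) k)"
    "h_norm s (\<lambda>k. flow (x - h) k * q (t + x) k) \<le> conv_bound s s * M * M" if "x \<in> {0..h}" for x
    using h_flow[OF in_h_q(1)[OF sub[OF that]]] in_h_q(2)[OF sub[OF that]] by (auto intro: order_trans)
  have I: "in_h s I" "h_norm s I \<le> h * (conv_bound s s * M * M)"
    unfolding I_def using h_integral[OF t(2) c fq] by auto
  have eI: "in_h s (\<lambda>k. of_real \<epsilon> * symbol_L \<epsilon> k * I k)"
    by (rule h_eps_symbol_L_2(1)[OF I(1)])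
  have eq: "(\<lambda>k. a (t + h) k - a t k) = (\<lambda>k. (flow (- h) k - 1) * a t k - of_real \<epsilon> * symbol_L \<epsilon> k * I k)"
    unfolding I_def using a_duhamel[OF t] by (simp add: fun_eq_iff algebra_simps)
  note F = h_flow_minus_1[OF in_h_a[OF t'] D0 D, where h = "- h"]
  show "in_h p (\<lambda>k. a (t + h) k - a t k)"
    unfolding eq by (intro h_diff F h_embed(1)[OF eI p])
  have "h_norm p (\<lambda>k. a (t + h) k - a t k)
      \<le> h_norm p (\<lambda>k. (flow (- h) k - 1) * a t k) + h_norm p (\<lambda>k. of_real \<epsilon> * symbol_L \<epsilon> k * I k)"
    unfolding eq by (intro h_diff F h_embed(1)[OF eI p])
  also have "\<dots> \<le> h * D * M + 2 * (h * (conv_bound s s * M * M))"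
  proof (rule add_mono)
    have "\<bar>- h\<bar> * D * h_norm s (a t) \<le> h * D * M"
      using t D0 by (intro mult_mono norm_a_le t') auto
    with F(2) show "h_norm p (\<lambda>k. (flow (- h) k - 1) * a t k) \<le> h * D * M"
      by (rule order_trans)
    show "h_norm p (\<lambda>k. of_real \<epsilon> * symbol_L \<epsilon> k * I k) \<le> 2 * (h * (conv_bound s s * M * M))"
      using h_embed(2)[OF eI p] h_eps_symbol_L_2(2)[OF I(1)] I(2) by linarith
  qed
  finally show "h_norm p (\<lambda>k. a (t + h) k - a t k) \<le> h * (D * M + 2 * (conv_bound s s * M * M))"
    by (simp add: algebra_simps)
qed

text \<open>The flow and \<open>q\<close> are varied one at a time; the increment of
  \<open>q\<close> is a difference of squares, with the sum measured in H^s and the difference in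
  H^p.\<close>

lemma q_variation:
  assumes t: "0 \<le> t" "0 \<le> h" "t + h \<le> T" and p: "0 \<le> p" "p \<le> s" and D0: "0 \<le> D"
    and D: "\<And>k. cmod (symbol_LP P \<epsilon> k) \<le> D * wt k powr ((s - p) / 2)"
  defines "B \<equiv> D * (conv_bound s s * M * M)
    + conv_bound s p * (2 * M) * (D * M + 2 * (conv_bound s s * M * M))"
  shows "in_h p (\<lambda>k. flow h k * q (t + h) k - q t k)"
    and "h_norm p (\<lambda>k. flow h k * q (t + h) k - q t k) \<le> h * B"
proof -
  have t': "t \<in> {0..T}" "t + h \<in> {0..T}"
    using t by auto
  have sum: "in_h s (\<lambda>k. a (t + h) k + a t k)" "h_norm s (\<lambda>k. a (t + h) k + a t k) \<le> 2 * M"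
    using h_add[OF in_h_a[OF t'(2)] in_h_a[OF t'(1)]] norm_a_le[OF t'(1)] norm_a_le[OF t'(2)] by auto
  note L = a_lipschitz[OF t p(2) D0 D]
  note F = h_flow_minus_1[OF in_h_q(1)[OF t'(2)] D0 D, where h = h]
  note C = h_conv[OF s p sum(1) L(1)]
  have eq: "(\<lambda>k. flow h k * q (t + h) k - q t k) = (\<lambda>k. (flow h k - 1) * q (t + h) k
      + conv (\<lambda>k. a (t + h) k + a t k) (\<lambda>k. a (t + h) k - a t k) k)"
    unfolding q_def conv_diff_squares[OF in_h_0[OF in_h_a[OF t'(2)]] in_h_0[OF in_h_a[OF t'(1)]], symmetric]
    by (simp add: algebra_simps)
  show "in_h p (\<lambda>k. flow h k * q (t + h) k - q t k)"
    unfolding eq by (intro h_add F C)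
  have "h_norm p (\<lambda>k. flow h k * q (t + h) k - q t k) \<le> h_norm p (\<lambda>k. (flow h k - 1) * q (t + h) k)
      + h_norm p (conv (\<lambda>k. a (t + h) k + a t k) (\<lambda>k. a (t + h) k - a t k))"
    unfolding eq by (intro h_add F C)
  also have "\<dots> \<le> h * D * (conv_bound s s * M * M)
      + conv_bound s p * (2 * M) * (h * (D * M + 2 * (conv_bound s s * M * M)))"
  proof (rule add_mono)
    have "\<bar>h\<bar> * D * h_norm s (q (t + h)) \<le> h * D * (conv_bound s s * M * M)"
      using t D0 by (intro mult_mono in_h_q t') auto
    with F(2) show "h_norm p (\<lambda>k. (flow h k - 1) * q (t + h) k) \<le> h * D * (conv_bound s s * M * M)"
      by (rule order_trans)
    have "conv_bound s p * h_norm s (\<lambda>k. a (t + h) k + a t k) * h_norm p (\<lambda>k. a (t + h) k - a t k)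
      \<le> conv_bound s p * (2 * M) * (h * (D * M + 2 * (conv_bound s s * M * M)))"
      using M_nonneg by (intro mult_mono sum L mult_left_mono) auto
    with C(2) show "h_norm p (conv (\<lambda>k. a (t + h) k + a t k) (\<lambda>k. a (t + h) k - a t k))
      \<le> conv_bound s p * (2 * M) * (h * (D * M + 2 * (conv_bound s s * M * M)))"
      by (rule order_trans)
  qed
  finally show "h_norm p (\<lambda>k. flow h k * q (t + h) k - q t k) \<le> h * B"
    by (simp add: B_def algebra_simps)
qed

text \<open>The linear terms of the exact solution and of the Lie step cancel. What remains is a
  time integral over length \<open>\<tau>\<close> whose integrand is itself of size
  \<open>\<tau>\<close>, whence the square of \<open>\<tau>\<close>.\<close>

lemma local_error:
  assumes t: "0 \<le> t" "0 \<le> \<tau>" "t + \<tau> \<le> T" and p: "0 \<le> p" "p \<le> s" and D0: "0 \<le> D"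
    and D: "\<And>k. cmod (symbol_LP P \<epsilon> k) \<le> D * wt k powr ((s - p) / 2)"
    and \<theta>: "0 \<le> \<theta>" "\<theta> \<le> 1" "\<theta> - 1 / 2 = (p - r) / 2"
  defines "B \<equiv> D * (conv_bound s s * M * M)
    + conv_bound s p * (2 * M) * (D * M + 2 * (conv_bound s s * M * M))"
  shows "in_h r (\<lambda>k. a (t + \<tau>) k - \<Phi> \<tau> (a t) k)"
    and "h_norm r (\<lambda>k. a (t + \<tau>) k - \<Phi> \<tau> (a t) k) \<le> 2 * \<epsilon> powr \<theta> * (\<tau> * (\<tau> * B))"
proof -
  have B: "0 \<le> B"
    unfolding B_def using D0 M_nonneg by auto
  \<comment> \<open>The Lie step amounts to freezing the twisted nonlinearity at
    \<open>x = 0\<close>; \<open>d\<close> is the resulting defect.\<close>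
  define d where "d x k = flow x k * q (t + x) k - q t k" for x k
  define J where "J k = integral {0..\<tau>} (\<lambda>x. d x k)" for k
  have cq: "continuous_on {0..\<tau>} (\<lambda>x. flow x k * q (t + x) k)" for k
    using t flow_continuous[of _ 0] by (intro continuous_on_mult continuous_on_compose2[OF q_continuous]
        continuous_intros) auto
  have c: "continuous_on {0..\<tau>} (\<lambda>x. d x k)" for k
    unfolding d_def by (intro continuous_on_diff cq continuous_on_const)
  have d: "in_h p (d x)" "h_norm p (d x) \<le> \<tau> * B" if "x \<in> {0..\<tau>}" for x
  proof -
    have x: "0 \<le> x" "x \<le> \<tau>" "t + x \<le> T"
      using that t by auto
    show "in_h p (d x)"
      unfolding d_def by (rule q_variation(1)[OF t(1) x(1) x(3) p D0 D])
    have "h_norm p (d x) \<le> x * B"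
      unfolding d_def B_def by (rule q_variation(2)[OF t(1) x(1) x(3) p D0 D])
    also have "\<dots> \<le> \<tau> * B"
      using x B by (intro mult_right_mono) auto
    finally show "h_norm p (d x) \<le> \<tau> * B" .
  qed
  have J: "in_h p J" "h_norm p J \<le> \<tau> * (\<tau> * B)"
    unfolding J_def using h_integral[OF t(2) c d] by auto
  have eq: "a (t + \<tau>) k - \<Phi> \<tau> (a t) k = - (flow (- \<tau>) k * (of_real \<epsilon> * symbol_L \<epsilon> k * J k))" for k
  proof -
    have "flow (x - \<tau>) k * q (t + x) k = flow (- \<tau>) k * (flow x k * q (t + x) k)" for x
      using flow_add[of "- \<tau>" x k] by simp
    then have "integral {0..\<tau>} (\<lambda>x. flow (x - \<tau>) k * q (t + x) k)
        = flow (- \<tau>) k * integral {0..\<tau>} (\<lambda>x. flow x k * q (t + x) k)"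
      by (simp only: integral_mult_right)
    moreover have "J k = integral {0..\<tau>} (\<lambda>x. flow x k * q (t + x) k) - of_real \<tau> * q t k"
      unfolding J_def d_def using t
      by (subst integral_diff) (auto intro!: integrable_continuous_interval cq simp: scaleR_conv_of_real)
    ultimately show ?thesis
      unfolding a_duhamel[OF t] \<Phi>_def q_def[symmetric]
      by (simp only: right_diff_distrib) (simp add: algebra_simps)
  qed
  note S = h_eps_symbol_L[OF J(1) \<theta>]
  show "in_h r (\<lambda>k. a (t + \<tau>) k - \<Phi> \<tau> (a t) k)"
    unfolding eq h_uminus by (intro h_flow S)
  have "h_norm r (\<lambda>k. a (t + \<tau>) k - \<Phi> \<tau> (a t) k) \<le> h_norm r (\<lambda>k. of_real \<epsilon> * symbol_L \<epsilon> k * J k)"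
    unfolding eq h_uminus by (intro h_flow S)
  also have "\<dots> \<le> 2 * \<epsilon> powr \<theta> * h_norm p J"
    by (rule S)
  also have "\<dots> \<le> 2 * \<epsilon> powr \<theta> * (\<tau> * (\<tau> * B))"
    by (intro mult_left_mono J) simp
  finally show "h_norm r (\<lambda>k. a (t + \<tau>) k - \<Phi> \<tau> (a t) k) \<le> 2 * \<epsilon> powr \<theta> * (\<tau> * (\<tau> * B))" .
qed

text \<open>The square of \<open>b\<close> is expanded around \<open>a t\<close>, so the bounds
  involve only \<open>M\<close> and the error \<open>e\<close>, and no norm of the numerical
  solution. A quadratic term in the error remains for the bootstrap to absorb.\<close>

lemma stability:
  assumes t: "t \<in> {0..T}" and \<tau>: "0 \<le> \<tau>" and r: "0 \<le> r" "r \<le> s" and b: "in_h s b"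
  defines "e \<equiv> (\<lambda>k. a t k - b k)"
  shows "in_h r (\<lambda>k. \<Phi> \<tau> (a t) k - \<Phi> \<tau> b k)"
    and "h_norm r (\<lambda>k. \<Phi> \<tau> (a t) k - \<Phi> \<tau> b k) \<le> h_norm r e
      + \<tau> * (4 * conv_bound s r * M * h_norm r e + 2 * lossy_conv_bound r * (h_norm r e)\<^sup>2)"
proof -
  have es: "in_h s e"
    unfolding e_def by (intro h_diff(1) in_h_a t b)
  have er: "in_h r e"
    by (rule h_embed(1)[OF es r(2)])
  note z = in_h_0[OF es] in_h_0[OF b] in_h_0[OF in_h_a[OF t]]
  have sq: "conv (a t) (a t) k - conv b b k = 2 * conv (a t) e k - conv e e k" for k
  proof -
    have "b = (\<lambda>k. a t k - e k)"
      by (simp add: e_def)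
    then have "conv b b k = conv b (a t) k - conv b e k"
      using conv_diff_right[OF z(2,3,1)] by simp
    also have "conv b (a t) k = conv (a t) (a t) k - conv (a t) e k"
      unfolding conv_commute[of b] using conv_diff_right[OF z(3,3,1)] by (simp add: e_def)
    also have "conv b e k = conv (a t) e k - conv e e k"
      using conv_diff_right[OF z(1,3,1)] by (simp add: conv_commute[of b] conv_commute[of "a t"] e_def)
    finally show ?thesis by simp
  qed
  note C1 = h_conv[OF s r in_h_a[OF t] er]
  note C2 = h_conv_lossy[OF r(1) er er]
  note S1 = h_eps_symbol_L_2[OF C1(1)]
  \<comment> \<open>Taking \<open>\<theta> = 0\<close> yields the full gain of one derivative, from
    \<open>r - 1\<close> back to \<open>r\<close>, without any power of
    \<open>\<epsilon>\<close>.\<close>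
  note S2 = h_eps_symbol_L[OF C2(1), of 0 r]
  have S2': "in_h r (\<lambda>k. of_real \<epsilon> * symbol_L \<epsilon> k * conv e e k)"
    "h_norm r (\<lambda>k. of_real \<epsilon> * symbol_L \<epsilon> k * conv e e k) \<le> 2 * h_norm (r - 1) (conv e e)"
    using S2 eps by auto
  define N where "N k = 2 * (of_real \<epsilon> * symbol_L \<epsilon> k * conv (a t) e k)
      - of_real \<epsilon> * symbol_L \<epsilon> k * conv e e k" for k
  have N: "in_h r N"
    unfolding N_def by (intro h_diff(1) h_cmult(1) S1 S2')
  have "h_norm r N \<le> h_norm r (\<lambda>k. 2 * (of_real \<epsilon> * symbol_L \<epsilon> k * conv (a t) e k))
      + h_norm r (\<lambda>k. of_real \<epsilon> * symbol_L \<epsilon> k * conv e e k)"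
    unfolding N_def by (intro h_diff(2) h_cmult(1) S1 S2')
  also have "\<dots> \<le> 2 * (2 * (conv_bound s r * M * h_norm r e)) + 2 * (lossy_conv_bound r * h_norm r e * h_norm r e)"
  proof (rule add_mono)
    have "h_norm r (conv (a t) e) \<le> conv_bound s r * M * h_norm r e"
      using C1(2) by (rule order_trans) (intro mult_right_mono mult_left_mono norm_a_le t; simp)
    then show "h_norm r (\<lambda>k. 2 * (of_real \<epsilon> * symbol_L \<epsilon> k * conv (a t) e k))
        \<le> 2 * (2 * (conv_bound s r * M * h_norm r e))"
      using h_cmult(2)[OF S1(1), of 2] S1(2) by simp
    show "h_norm r (\<lambda>k. of_real \<epsilon> * symbol_L \<epsilon> k * conv e e k)
        \<le> 2 * (lossy_conv_bound r * h_norm r e * h_norm r e)"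
      using S2'(2) C2(2) by simp
  qed
  finally have N': "h_norm r N \<le> 4 * conv_bound s r * M * h_norm r e + 2 * lossy_conv_bound r * (h_norm r e)\<^sup>2"
    by (simp add: power2_eq_square mult_ac)
  have eq: "(\<lambda>k. \<Phi> \<tau> (a t) k - \<Phi> \<tau> b k) = (\<lambda>k. flow (- \<tau>) k * (e k - of_real \<tau> * N k))"
  proof
    fix k
    have "\<Phi> \<tau> (a t) k - \<Phi> \<tau> b k = flow (- \<tau>) k * (e k
        - of_real \<tau> * (of_real \<epsilon> * symbol_L \<epsilon> k * (conv (a t) (a t) k - conv b b k)))"
      by (simp add: \<Phi>_def e_def algebra_simps)
    also have "of_real \<epsilon> * symbol_L \<epsilon> k * (conv (a t) (a t) k - conv b b k) = N k"
      unfolding sq N_def by (simp add: algebra_simps)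
    finally show "\<Phi> \<tau> (a t) k - \<Phi> \<tau> b k = flow (- \<tau>) k * (e k - of_real \<tau> * N k)" .
  qed
  have D: "in_h r (\<lambda>k. e k - of_real \<tau> * N k)"
    by (intro h_diff(1) h_cmult(1) er N)
  show "in_h r (\<lambda>k. \<Phi> \<tau> (a t) k - \<Phi> \<tau> b k)"
    unfolding eq by (rule h_flow(1)[OF D])
  have "h_norm r (\<lambda>k. \<Phi> \<tau> (a t) k - \<Phi> \<tau> b k) \<le> h_norm r (\<lambda>k. e k - of_real \<tau> * N k)"
    unfolding eq by (rule h_flow(2)[OF D])
  also have "\<dots> \<le> h_norm r e + h_norm r (\<lambda>k. of_real \<tau> * N k)"
    by (intro h_diff(2) h_cmult(1) er N)
  also have "h_norm r (\<lambda>k. of_real \<tau> * N k) \<le> \<tau> * h_norm r N"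
    using h_cmult(2)[OF N, of "of_real \<tau>"] \<tau> by simp
  also have "\<tau> * h_norm r N \<le> \<tau> * (4 * conv_bound s r * M * h_norm r e + 2 * lossy_conv_bound r * (h_norm r e)\<^sup>2)"
    by (intro mult_left_mono N' \<tau>)
  finally show "h_norm r (\<lambda>k. \<Phi> \<tau> (a t) k - \<Phi> \<tau> b k) \<le> h_norm r e
      + \<tau> * (4 * conv_bound s r * M * h_norm r e + 2 * lossy_conv_bound r * (h_norm r e)\<^sup>2)"
    by simp
qed

section \<open>Convergence\<close>

text \<open>Discrete Gronwall with a bootstrap: while the error is at most 1, its square is at most
  itself, and a step amplifies it by at most
  \<open>1 + \<tau> * A \<le> exp (\<tau> * A)\<close>.\<close>

lemma lie_convergence:
  fixes \<tau> \<delta> r :: real and n :: nat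
  assumes \<tau>: "0 \<le> \<tau>" "real n * \<tau> \<le> T" and r: "0 \<le> r" "r \<le> s"
    and loc: "\<And>t. 0 \<le> t \<Longrightarrow> t + \<tau> \<le> T \<Longrightarrow> h_norm r (\<lambda>k. a (t + \<tau>) k - \<Phi> \<tau> (a t) k) \<le> \<tau> * (\<tau> * \<delta>)"
  defines "A \<equiv> 4 * conv_bound s r * M + 2 * lossy_conv_bound r"
  assumes \<delta>: "0 \<le> \<delta>" and small: "\<tau> * T * \<delta> * exp (T * A) \<le> 1"
  shows "h_norm r (\<lambda>k. a (real n * \<tau>) k - (\<Phi> \<tau> ^^ n) (a 0) k) \<le> \<tau> * T * \<delta> * exp (T * A)"
proof -
  have A: "0 \<le> A"
    by (simp add: A_def M_nonneg)
  define b where "b n = (\<Phi> \<tau> ^^ n) (a 0)" for n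
  define E where "E n = h_norm r (\<lambda>k. a (real n * \<tau>) k - b n k)" for n
  have bound: "real n * \<tau> * \<tau> * \<delta> * exp (real n * \<tau> * A) \<le> \<tau> * T * \<delta> * exp (T * A)"
    if "real n * \<tau> \<le> T" for n
  proof -
    have "(real n * \<tau>) * (\<tau> * \<delta>) * exp (real n * \<tau> * A) \<le> T * (\<tau> * \<delta>) * exp (T * A)"
      using that T A \<tau> \<delta> by (intro mult_mono) (auto intro!: mult_right_mono)
    then show ?thesis by (simp add: mult_ac)
  qed
  have "E n \<le> real n * \<tau> * \<tau> * \<delta> * exp (real n * \<tau> * A)" if "real n * \<tau> \<le> T" for n
    using that
  proof (induction n)
    case 0
    show ?case by (simp add: E_def b_def h_norm_def)
  next
    case (Suc n)
    define t where "t = real n * \<tau>"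
    define e where "e = (\<lambda>k. a t k - b n k)"
    have t: "0 \<le> t" "t + \<tau> \<le> T" "real (Suc n) * \<tau> = t + \<tau>"
      using Suc.prems \<tau> by (auto simp: t_def algebra_simps)
    then have tT: "t \<in> {0..T}"
      using \<tau> by auto
    have bn: "in_h s (b n)"
      unfolding b_def by (rule lie_splitting_rep(2))
    have "t \<le> T"
      using tT by simp
    then have IH: "E n \<le> t * \<tau> * \<delta> * exp (t * A)"
      using Suc.IH by (simp add: t_def)
    \<comment> \<open>The bootstrap closes here: the inductive bound and \<open>small\<close> keep
      the error below 1 before the quadratic term is estimated.\<close>
    also have "\<dots> \<le> 1"
      using bound[of n] \<open>t \<le> T\<close> small by (simp add: t_def)
    finally have E1: "E n \<le> 1" .
    have E0: "0 \<le> E n"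
      by (simp add: E_def)
    have S: "in_h r (\<lambda>k. \<Phi> \<tau> (a t) k - \<Phi> \<tau> (b n) k)"
      "h_norm r (\<lambda>k. \<Phi> \<tau> (a t) k - \<Phi> \<tau> (b n) k) \<le> E n
        + \<tau> * (4 * conv_bound s r * M * E n + 2 * lossy_conv_bound r * (E n)\<^sup>2)"
      using stability[OF tT \<tau>(1) r bn] by (simp_all add: E_def t_def)
    have L: "in_h r (\<lambda>k. a (t + \<tau>) k - \<Phi> \<tau> (a t) k)"
      using t tT \<tau> by (intro h_embed(1)[OF _ r(2)] h_diff(1) in_h_a in_h_\<Phi>) auto
    \<comment> \<open>The new error is the local error at the exact solution plus the propagated old
      error.\<close>
    have "E (Suc n) = h_norm r (\<lambda>k. (a (t + \<tau>) k - \<Phi> \<tau> (a t) k) + (\<Phi> \<tau> (a t) k - \<Phi> \<tau> (b n) k))"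
      unfolding E_def t(3) by (simp add: b_def)
    also have "\<dots> \<le> \<tau> * (\<tau> * \<delta>) + (E n + \<tau> * (4 * conv_bound s r * M * E n + 2 * lossy_conv_bound r * (E n)\<^sup>2))"
      using h_add(2)[OF L S(1)] loc[OF t(1,2)] S(2) by linarith
    also have "\<dots> \<le> \<tau> * (\<tau> * \<delta>) + (1 + \<tau> * A) * E n"
    proof -
      have "2 * lossy_conv_bound r * (E n)\<^sup>2 \<le> 2 * lossy_conv_bound r * E n"
        using E0 E1 by (intro mult_left_mono) (auto simp: power2_eq_square mult_left_le)
      then have "\<tau> * (4 * conv_bound s r * M * E n + 2 * lossy_conv_bound r * (E n)\<^sup>2) \<le> \<tau> * (A * E n)"
        using \<tau> by (intro mult_left_mono) (auto simp: A_def algebra_simps)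
      then show ?thesis
        by (simp add: algebra_simps)
    qed
    also have "\<dots> \<le> \<tau> * (\<tau> * \<delta>) + exp (\<tau> * A) * (t * \<tau> * \<delta> * exp (t * A))"
      using \<tau> A E0 by (intro add_left_mono mult_mono exp_ge_add_one_self IH) auto
    \<comment> \<open>An exponential that is at least 1 gives the local error the same factor as the
      propagated error, so that the two add up.\<close>
    also have "\<dots>
        \<le> \<tau> * (\<tau> * \<delta>) * exp ((t + \<tau>) * A) + exp (\<tau> * A) * (t * \<tau> * \<delta> * exp (t * A))"
    proof -
      have "1 \<le> exp ((t + \<tau>) * A)"
        using t \<tau> A by simp
      from mult_left_mono[OF this, of "\<tau> * (\<tau> * \<delta>)"] show ?thesis
        using \<tau> \<delta> by simp
    qed
    also have "\<dots> = (t + \<tau>) * \<tau> * \<delta> * exp ((t + \<tau>) * A)"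
      by (simp add: exp_add algebra_simps)
    finally show ?case
      unfolding t(3) by simp
  qed
  from order_trans[OF this bound] show ?thesis
    using \<tau>(2) by (simp add: E_def b_def)
qed

end

section \<open>Choice of the exponents and of the constant\<close>

theorem theorem6:
  fixes P :: "complex poly" and l :: nat and T \<sigma> r :: real
  assumes "degree P = l" and "l \<ge> 1"
    and "\<forall>x::real. Re (poly P (\<i> * of_real x)) = 0"
    and "T > 0"
    and "0 \<le> \<sigma>" and "\<sigma> \<le> 1" and "r \<ge> 0"
    and "r + 1 - 2 * \<sigma> + real l > 1 / 2"
  shows "\<exists>K :: real \<Rightarrow> real. (\<forall>x\<ge>0. K x > 0) \<and>
    (\<forall>(\<epsilon>::real) (u :: real \<Rightarrow> real \<Rightarrow> complex).
       0 < \<epsilon> \<and> \<epsilon> \<le> 1 \<and> u \<in> cont_sobolev T (r + 1 - 2 * \<sigma> + real l) \<and> mild_solution P \<epsilon> T u \<longrightarrow>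
       (\<exists>\<tau>\<^sub>0>0. \<forall>(\<tau>::real) (n::nat). 0 < \<tau> \<and> \<tau> \<le> \<tau>\<^sub>0 \<and> real n * \<tau> \<le> T \<longrightarrow>
          (\<lambda>x. u (real n * \<tau>) x - lie_splitting P \<epsilon> \<tau> (u 0) n x) \<in> sobolev r \<and>
          sobolev_norm r (\<lambda>x. u (real n * \<tau>) x - lie_splitting P \<epsilon> \<tau> (u 0) n x)
            \<le> \<tau> * \<epsilon> powr (1 - \<sigma>)
              * K (SUP t\<in>{0..T}. sobolev_norm (r + 1 - 2 * \<sigma> + real l) (u t))))"
proof -
  define s where "s = r + 1 - 2 * \<sigma> + real l"
  \<comment> \<open>Time increments are measured \<open>real l\<close> orders below
    \<open>s\<close>, but never below order 0, where the product estimate stops.\<close>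
  define p where "p = max (s - real l) 0"
  \<comment> \<open>Half of the derivatives that must be recovered from the denominator when
    \<open>s < real l\<close>; otherwise 0.\<close>
  define \<mu> where "\<mu> = (p - (s - real l)) / 2"
  define \<theta> where "\<theta> = 1 - \<sigma> + \<mu>"
  define S where "S = 2 * (\<Sum>i\<le>degree P. cmod (coeff P i))"
  define B where "B x = S * (conv_bound s s * x * x)
    + conv_bound s p * (2 * x) * (S * x + 2 * (conv_bound s s * x * x))" for x
  define A where "A x = 4 * conv_bound s r * x + 2 * lossy_conv_bound r" for x
  \<comment> \<open>The product is the bound of \<open>lie_convergence\<close> with the 2 of
    \<open>local_error\<close>; the summand 1 makes \<open>K\<close> positive, also at 0, and
    invertible for the step size.\<close>
  define K where "K x = T * (2 * B x) * exp (T * A x) + 1" for x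
  have s: "1 / 2 < s"
    using assms(8) by (simp add: s_def)
  have p: "0 \<le> p" "p \<le> s"
    using s by (auto simp: p_def)
  \<comment> \<open>Here \<open>l \<ge> 1\<close> and \<open>\<sigma> \<le> 1\<close> enter:
    \<open>s - r = 1 - 2 * \<sigma> + real l\<close> is nonnegative.\<close>
  have r: "0 \<le> r" "r \<le> s"
    using assms by (auto simp: s_def)
  have \<mu>: "0 \<le> \<mu>" "\<mu> \<le> 1" and \<mu>_eq: "real l / 2 - \<mu> = (s - p) / 2"
    using assms by (auto simp: \<mu>_def p_def s_def field_simps)
  have \<theta>: "0 \<le> \<theta>" "\<theta> \<le> 1" and \<theta>_eq: "\<theta> - 1 / 2 = (p - r) / 2"
    using assms by (auto simp: \<theta>_def \<mu>_def p_def s_def field_simps max_def)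
  have S: "0 \<le> S"
    by (simp add: S_def sum_nonneg)
  have B0: "0 \<le> B x" if "0 \<le> x" for x
    using that S by (simp add: B_def)
  have K1: "1 \<le> K x" if "0 \<le> x" for x
    using B0[OF that] assms(4) by (simp add: K_def)
  have main: "\<exists>\<tau>\<^sub>0>0. \<forall>(\<tau>::real) (n::nat). 0 < \<tau> \<and> \<tau> \<le> \<tau>\<^sub>0 \<and> real n * \<tau> \<le> T \<longrightarrow>
          (\<lambda>x. u (real n * \<tau>) x - lie_splitting P \<epsilon> \<tau> (u 0) n x) \<in> sobolev r \<and>
          sobolev_norm r (\<lambda>x. u (real n * \<tau>) x - lie_splitting P \<epsilon> \<tau> (u 0) n x)
            \<le> \<tau> * \<epsilon> powr (1 - \<sigma>) * K (SUP t\<in>{0..T}. sobolev_norm s (u t))"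
    if eps: "0 < \<epsilon>" "\<epsilon> \<le> 1" and u: "u \<in> cont_sobolev T s" "mild_solution P \<epsilon> T u" for \<epsilon> u
  proof -
    interpret bbm_solution P \<epsilon> T s u
      by unfold_locales (use assms eps u s in auto)
    define D where "D = S * \<epsilon> powr - \<mu>"
    define \<delta> where "\<delta> = \<epsilon> powr (1 - \<sigma>) * (2 * B M)"
    have D0: "0 \<le> D"
      using S by (simp add: D_def)
    have D: "cmod (symbol_LP P \<epsilon> k) \<le> D * wt k powr ((s - p) / 2)" for k
      using symbol_LP_le[OF eps \<mu>, of P k] unfolding assms(1) \<mu>_eq S_def[unfolded assms(1), symmetric] D_def .
    have \<delta>0: "0 \<le> \<delta>"
      using B0[OF M_nonneg] by (simp add: \<delta>_def)
    have loc: "h_norm r (\<lambda>k. a (t + \<tau>) k - \<Phi> \<tau> (a t) k) \<le> \<tau> * (\<tau> * \<delta>)"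
      if "0 \<le> \<tau>" "0 \<le> t" "t + \<tau> \<le> T" for \<tau> t
    proof -
      \<comment> \<open>Terms without a negative power of \<open>\<epsilon>\<close> may be enlarged
        by it, so that it factors out of the whole bound.\<close>
      have e1: "1 \<le> \<epsilon> powr - \<mu>"
        using powr_mono'[of "- \<mu>" 0 \<epsilon>] eps \<mu> by simp
      have "D * M + 2 * (conv_bound s s * M * M) \<le> \<epsilon> powr - \<mu> * (S * M + 2 * (conv_bound s s * M * M))"
        using mult_right_mono[OF e1, of "2 * (conv_bound s s * M * M)"] M_nonneg
        by (simp add: D_def algebra_simps)
      then have "D * (conv_bound s s * M * M) + conv_bound s p * (2 * M) * (D * M + 2 * (conv_bound s s * M * M))
          \<le> D * (conv_bound s s * M * M)
            + conv_bound s p * (2 * M) * (\<epsilon> powr - \<mu> * (S * M + 2 * (conv_bound s s * M * M)))"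
        using M_nonneg by (intro add_left_mono mult_left_mono) auto
      also have "\<dots> = \<epsilon> powr - \<mu> * B M"
        by (simp add: D_def B_def algebra_simps)
      finally have le: "D * (conv_bound s s * M * M)
        + conv_bound s p * (2 * M) * (D * M + 2 * (conv_bound s s * M * M)) \<le> \<epsilon> powr - \<mu> * B M" .
      have "h_norm r (\<lambda>k. a (t + \<tau>) k - \<Phi> \<tau> (a t) k) \<le> 2 * \<epsilon> powr \<theta> * (\<tau> * (\<tau> *
          (D * (conv_bound s s * M * M)
            + conv_bound s p * (2 * M) * (D * M + 2 * (conv_bound s s * M * M)))))"
        by (rule local_error(2)[OF that(2,1,3) p D0 D \<theta> \<theta>_eq])
      also have "\<dots> \<le> 2 * \<epsilon> powr \<theta> * (\<tau> * (\<tau> * (\<epsilon> powr - \<mu> * B M)))"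
        using that by (intro mult_left_mono le) auto
      also have "\<dots> = \<tau> * (\<tau> * ((\<epsilon> powr \<theta> * \<epsilon> powr - \<mu>) * (2 * B M)))"
        by simp
      \<comment> \<open>The loss in the generator is repaid exactly, since
        \<open>\<theta> - \<mu> = 1 - \<sigma>\<close>.\<close>
      also have "\<epsilon> powr \<theta> * \<epsilon> powr - \<mu> = \<epsilon> powr (1 - \<sigma>)"
        by (simp add: \<theta>_def powr_add[symmetric])
      finally show ?thesis
        by (simp add: \<delta>_def)
    qed
    have KM: "1 \<le> K M"
      by (rule K1[OF M_nonneg])
    have le_K: "\<tau> * T * \<delta> * exp (T * A M) \<le> \<tau> * \<epsilon> powr (1 - \<sigma>) * K M" if "0 \<le> \<tau>" for \<tau>
    proof -
      have "\<tau> * T * \<delta> * exp (T * A M) = \<tau> * \<epsilon> powr (1 - \<sigma>) * (T * (2 * B M) * exp (T * A M))"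
        by (simp add: \<delta>_def)
      also have "\<dots> \<le> \<tau> * \<epsilon> powr (1 - \<sigma>) * K M"
        using that by (intro mult_left_mono) (auto simp: K_def)
      finally show ?thesis .
    qed
    have M_eq: "(SUP t\<in>{0..T}. sobolev_norm s (u t)) = M"
      by (simp add: M_def sobolev_norm_u)
    show ?thesis
      unfolding M_eq
    \<comment> \<open>As \<open>\<epsilon> powr (1 - \<sigma>) \<le> 1\<close>, this step size makes
      the claimed error bound at most 1, which is the smallness the bootstrap needs.\<close>
    proof (intro exI[of _ "1 / K M"] conjI allI impI; (elim conjE)?)
      show "0 < 1 / K M"
        using KM by simp
      fix \<tau> :: real and n :: nat
      assume \<tau>: "0 < \<tau>" "\<tau> \<le> 1 / K M" "real n * \<tau> \<le> T"
      have "\<epsilon> powr (1 - \<sigma>) \<le> 1"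
        using eps assms by (intro powr_le1) auto
      then have "\<tau> * \<epsilon> powr (1 - \<sigma>) * K M \<le> \<tau> * 1 * K M"
        using \<tau> KM by (intro mult_right_mono mult_left_mono) auto
      also have "\<dots> \<le> 1"
        using \<tau>(2) KM by (simp add: field_simps)
      finally have "\<tau> * \<epsilon> powr (1 - \<sigma>) * K M \<le> 1" .
      with le_K[OF less_imp_le[OF \<tau>(1)]] have small: "\<tau> * T * \<delta> * exp (T * A M) \<le> 1"
        by (rule order_trans)
      have tn: "real n * \<tau> \<in> {0..T}"
        using \<tau> by simp
      have err: "h_norm r (\<lambda>k. a (real n * \<tau>) k - (\<Phi> \<tau> ^^ n) (a 0) k) \<le> \<tau> * \<epsilon> powr (1 - \<sigma>) * K M"
        using \<tau>(1) small le_K[OF less_imp_le[OF \<tau>(1)]] unfolding A_def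
        by (intro order_trans[OF lie_convergence[OF _ \<tau>(3) r loc \<delta>0]]) auto
      have rep: "series_rep (\<lambda>x. u (real n * \<tau>) x - lie_splitting P \<epsilon> \<tau> (u 0) n x)
          (\<lambda>k. a (real n * \<tau>) k - (\<Phi> \<tau> ^^ n) (a 0) k)"
        using series_rep_diff[OF u_rep[OF tn] lie_splitting_rep(1)[of \<tau> n], of 1] by simp
      have in_r: "in_h r (\<lambda>k. a (real n * \<tau>) k - (\<Phi> \<tau> ^^ n) (a 0) k)"
        by (intro h_embed(1)[OF _ r(2)] h_diff(1) in_h_a[OF tn] lie_splitting_rep(2))
      show "(\<lambda>x. u (real n * \<tau>) x - lie_splitting P \<epsilon> \<tau> (u 0) n x) \<in> sobolev r"
        by (rule series_rep_sobolev(1)[OF rep in_r])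
      show "sobolev_norm r (\<lambda>x. u (real n * \<tau>) x - lie_splitting P \<epsilon> \<tau> (u 0) n x)
          \<le> \<tau> * \<epsilon> powr (1 - \<sigma>) * K M"
        unfolding series_rep_sobolev(2)[OF rep in_r] by (rule err)
    qed
  qed
  show ?thesis
  proof (intro exI[of _ K] conjI allI impI)
    show "0 < K x" if "0 \<le> x" for x
      using K1[OF that] by simp
  qed (use main in \<open>auto simp: s_def\<close>)
qed

end
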